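(* Let $\Omega\subset\mathbb{R}^2$ be a Jordan domain and let $\psi:[0,\infty)\to[0,\infty)$ be a control function. Then $\Omega$ has the three point property with the control function $\psi$ if and only if $\Omega$ is $\psi^{-1}$-locally connected.
   Context: $B(x,r)$ is the open disk in $\mathbb{R}^2$ with center $x$ and radius $r$. A Jordan domain is the bounded component of the complement of a Jordan curve in $\mathbb{R}^2$. Control function: both $\psi$ and its inverse $\psi^{-1}$ are smooth increasing functions from $[0,\infty)$ to $[0,\infty)$, with $\psi(0)=0$ and $\psi(r)\ge r$ (equivalently $\psi^{-1}(r)\le r$) for all $r>0$. Moreover the function $t\mapsto t/\psi^{-1}(t)^2$ is decreasing, and there are constants $C_1,C_2$ such that $C_1\psi(t)\le\psi(2t)\le C_2\psi(t)$ and $C_1\psi^{-1}(t)\le\psi^{-1}(2t)\le C_2\psi^{-1}(t)$ for all $t>0$. Three point property with the control function $\psi$: there is a constant $C\ge 1$ such that for each pair of distinct points $P_1,P_2\in\partial\Omega$, $$\min_{i=1,2}\operatorname{diam}(\gamma_i)\le\psi(C|P_1-P_2|),$$ where $\gamma_1,\gamma_2$ are the components of $\partial\Omega\setminus\{P_1,P_2\}$. $\psi^{-1}$-locally connected: for each $x\in\mathbb{R}^2$ and all $r>0$, (i) each pair of points in $B(x,r)\cap\Omega$ can be joined by an arc in $B(x,\psi(r))\cap\Omega$, and (ii) each pair of points in $\Omega\setminus B(x,r)$ can be joined by an arc in $\Omega\setminus B(x,\psi^{-1}(r))$.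
   Formalization: Local connectivity is asserted for ψ(Ct) with some constant C ≥ 1 instead of ψ itself; without a constant the three point property does not imply it (ψ(t)=t and an L-shaped domain). *)

theory Defs
  imports "HOL-Analysis.Analysis"
begin

definition jordan_domain :: "(real^2) set \<Rightarrow> bool" where
  "jordan_domain \<Omega> \<longleftrightarrow>
     (\<exists>c :: real \<Rightarrow> real^2. simple_path c \<and> pathfinish c = pathstart c \<and>
        \<Omega> \<in> components (- path_image c) \<and> bounded \<Omega>)"

text \<open>A function \<open>[0,\<infinity>) \<rightarrow> [0,\<infinity>)\<close> is represented by a total function on the reals whose values
  at negative arguments are irrelevant; \<open>psi_inv \<psi>\<close> is the inverse of its restriction
  to \<open>[0,\<infinity>)\<close>.\<close>

definition psi_inv :: "(real \<Rightarrow> real) \<Rightarrow> real \<Rightarrow> real" where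
  "psi_inv \<psi> = inv_into {0..} \<psi>"

text \<open>Smoothness of \<open>\<psi>\<close> and of its inverse is required on the open half-line only: one-sided
  smoothness of both functions at \<open>0\<close> would force a finite nonzero derivative of \<open>\<psi>\<close> at \<open>0\<close> and
  so exclude control functions such as \<open>\<psi>(t) = t powr a\<close> with \<open>0 < a < 1\<close> near \<open>0\<close>.\<close>

definition smooth_pos :: "(real \<Rightarrow> real) \<Rightarrow> bool" where
  "smooth_pos f \<longleftrightarrow> (\<forall>n. \<forall>t>0. (deriv ^^ n) f field_differentiable (at t))"

definition control_function :: "(real \<Rightarrow> real) \<Rightarrow> bool" where
  "control_function \<psi> \<longleftrightarrow>
     bij_betw \<psi> {0..} {0..} \<and> strict_mono_on {0..} \<psi> \<and>
     smooth_pos \<psi> \<and> smooth_pos (psi_inv \<psi>) \<and>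
     \<psi> 0 = 0 \<and> (\<forall>r>0. r \<le> \<psi> r) \<and>
     antimono_on {0<..} (\<lambda>t. t / (psi_inv \<psi> t)\<^sup>2) \<and>
     (\<exists>C1>0. \<exists>C2>0. \<forall>t>0.
        C1 * \<psi> t \<le> \<psi> (2 * t) \<and> \<psi> (2 * t) \<le> C2 * \<psi> t \<and>
        C1 * psi_inv \<psi> t \<le> psi_inv \<psi> (2 * t) \<and> psi_inv \<psi> (2 * t) \<le> C2 * psi_inv \<psi> t)"

text \<open>For a Jordan domain the set of components below has exactly two elements.\<close>

definition three_point_property :: "(real \<Rightarrow> real) \<Rightarrow> (real^2) set \<Rightarrow> bool" where
  "three_point_property \<psi> \<Omega> \<longleftrightarrow>
     (\<exists>C\<ge>1. \<forall>P1\<in>frontier \<Omega>. \<forall>P2\<in>frontier \<Omega>. P1 \<noteq> P2 \<longrightarrow>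
        Min (diameter ` components (frontier \<Omega> - {P1, P2})) \<le> \<psi> (C * dist P1 P2))"

definition joined_by_arc_in :: "(real^2) set \<Rightarrow> real^2 \<Rightarrow> real^2 \<Rightarrow> bool" where
  "joined_by_arc_in S p q \<longleftrightarrow>
     (\<exists>g. arc g \<and> pathstart g = p \<and> pathfinish g = q \<and> path_image g \<subseteq> S)"

text \<open>The library's \<open>arc\<close> is injective, so a pair of points is a pair of distinct points.
  The argument is \<open>\<psi>\<close>; the property is called \<open>\<psi>\<^sup>-\<^sup>1\<close>-local connectivity.\<close>

definition psi_inv_locally_connected :: "(real \<Rightarrow> real) \<Rightarrow> (real^2) set \<Rightarrow> bool" where
  "psi_inv_locally_connected \<psi> \<Omega> \<longleftrightarrow>
     (\<forall>x. \<forall>r>0.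
        (\<forall>p \<in> ball x r \<inter> \<Omega>. \<forall>q \<in> ball x r \<inter> \<Omega>. p \<noteq> q \<longrightarrow>
            joined_by_arc_in (ball x (\<psi> r) \<inter> \<Omega>) p q) \<and>
        (\<forall>p \<in> \<Omega> - ball x r. \<forall>q \<in> \<Omega> - ball x r. p \<noteq> q \<longrightarrow>
            joined_by_arc_in (\<Omega> - ball x (psi_inv \<psi> r)) p q))"

text \<open>The three point property allows a multiplicative constant, \<open>\<psi>(C t)\<close>, whereas the definition
  of local connectivity does not.  Read with no constant at all, the equivalence of the two is
  false: let \<open>\<psi>(t) = t\<close> and let \<open>\<Omega>\<close> be the L-shaped domain \<open>(-1,1)\<^sup>2\<close> minus \<open>[0,1)\<^sup>2\<close>.
  Its boundary is a polygon, so \<open>\<Omega>\<close> has the three point property with \<open>\<psi>\<close>; but if \<open>e\<close> is small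
  and \<open>e < r < e * sqrt 2\<close>, then the disk with center \<open>(e,e)\<close> and radius \<open>r\<close> meets \<open>\<Omega>\<close> in a
  disconnected set, so condition (i) fails.  A control function therefore matters only up to
  a rescaling \<open>t \<mapsto> \<psi>(C t)\<close> with \<open>C \<ge> 1\<close>, which is again a control function with inverse
  \<open>t \<mapsto> \<psi>\<^sup>-\<^sup>1(t) / C\<close> and yields the same three point property.  Local connectivity is
  accordingly asserted for some such rescaling.\<close>

end

theory Submission
  imports Defs
begin

text \<open>
  The doubling bound for \<open>\<psi>\<^sup>-\<^sup>1\<close> gives \<open>2 \<psi>(s) \<le> \<psi>(K s)\<close>, so multiplicative constants outside \<open>\<psi>\<close> can be
  absorbed by rescaling its argument.

  Three points imply local connectivity: if \<open>\<partial>\<Omega>\<close> leaves \<open>B(x,R)\<close>, then all of \<open>\<partial>\<Omega> \<inter> cball x r\<close> lies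
  on one arc \<open>\<sigma>\<close> of \<open>\<partial>\<Omega>\<close> whose end points are in \<open>cball x r\<close>. The complementary arc \<open>\<tau>\<close> is too large, so
  the three point property confines \<open>\<sigma>\<close> to \<open>B(x,R)\<close>. Janiszewski's theorem for \<open>\<partial>\<Omega>\<close> and \<open>\<partial>B(x,R) \<union> \<tau>\<close>
  (common part \<open>\<tau>\<close>) yields (i), and for \<open>\<partial>\<Omega>\<close> and \<open>cball x r \<union> \<sigma>\<close> (common part \<open>\<sigma>\<close>) it yields (ii).

  Conversely, if both arcs between \<open>P\<^sub>1\<close> and \<open>P\<^sub>2\<close> contain points \<open>Q\<^sub>1\<close>, \<open>Q\<^sub>2\<close> far away, then the segment
  \<open>P\<^sub>1P\<^sub>2\<close> contains a segment \<open>AB\<close> with \<open>A\<close>, \<open>B\<close> separated on \<open>\<partial>\<Omega>\<close> by \<open>Q\<^sub>1\<close>, \<open>Q\<^sub>2\<close> and with no interior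
  point on \<open>\<partial>\<Omega>\<close>. If \<open>AB\<close> runs inside \<open>\<Omega>\<close>, it is a crosscut separating points near \<open>Q\<^sub>1\<close> from points
  near \<open>Q\<^sub>2\<close>, against (ii). If it runs outside, (i) provides a crosscut \<open>g\<close> of \<open>\<Omega>\<close> near \<open>P\<^sub>1\<close> from near \<open>A\<close>
  to near \<open>B\<close>; Janiszewski's theorem applied to \<open>g \<union> AB\<close> and \<open>\<partial>\<Omega> \<union> AB\<close> shows that \<open>g\<close> does not
  separate, a contradiction.
\<close>

subsection \<open>Jordan curves and crosscuts in the plane\<close>

text \<open>Only the parameters 0 and 1 of a simple path may share a value, so one parameter
  strictly between them forces equality.\<close>

lemma simple_path_eqD:
  assumes "simple_path c" "c s = c t" "s \<in> {0..1}" "t \<in> {0<..<1}"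
  shows "s = t"
  using assms by (fastforce simp: simple_path_def loop_free_def)

text \<open>The parametrization is part of the data, so that the base point \<open>c 0\<close> can
  be placed where an argument wants it. The type is left open because the notion is moved between
  \<open>real^2\<close> and \<open>complex\<close>.\<close>

definition jordan_boundary :: "(real \<Rightarrow> 'a::real_normed_vector) \<Rightarrow> 'a set \<Rightarrow> bool" where
  "jordan_boundary c U \<longleftrightarrow> simple_path c \<and> pathfinish c = pathstart c \<and>
     open U \<and> connected U \<and> bounded U \<and> U \<noteq> {} \<and> frontier U = path_image c"

lemma jordan_boundary_disjoint:
  assumes "jordan_boundary c U"
  shows "U \<inter> path_image c = {}"
  using assms frontier_disjoint_eq[of U] by (auto simp: jordan_boundary_def)

text \<open>A connected set that misses the curve and meets \<open>U\<close> lies in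
  \<open>U\<close>. The outside is unbounded, so it cannot meet \<open>U\<close>; the inside is
  connected and does meet \<open>U\<close>.\<close>

lemma jordan_boundary_inside:
  fixes c :: "real \<Rightarrow> complex"
  assumes "jordan_boundary c U"
  shows "U = inside (path_image c)"
proof -
  note jb = assms[unfolded jordan_boundary_def]
  note dj = jordan_boundary_disjoint[OF assms]
  have J: "connected (inside (path_image c))" "connected (outside (path_image c))"
    "\<not> bounded (outside (path_image c))" "inside (path_image c) \<noteq> {}"
    "inside (path_image c) \<union> outside (path_image c) = - path_image c"
    using Jordan_inside_outside[of c] jb by auto
  have sub: "C \<subseteq> U" if "connected C" "C \<inter> U \<noteq> {}" "C \<inter> path_image c = {}" for C
    using connected_Int_frontier[of C U] that jb by auto
  have "outside (path_image c) \<inter> U = {}"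
  proof (rule ccontr)
    assume "outside (path_image c) \<inter> U \<noteq> {}"
    then have "outside (path_image c) \<subseteq> U"
      using J(2) outside_no_overlap by (intro sub) auto
    then show False using J(3) jb bounded_subset by blast
  qed
  then have "U \<subseteq> inside (path_image c)"
    using dj J(5) by blast
  moreover have "inside (path_image c) \<subseteq> U"
    using J(1) inside_no_overlap[of "path_image c"] calculation jb
    by (intro sub) auto
  ultimately show ?thesis by auto
qed

text \<open>The crosscut and the two boundary arcs form a theta curve, which splits the rest of
  \<open>U\<close> into two disjoint open insides. Each of \<open>c m\<close> and \<open>c 0\<close>
  lies off one of the two closed curves, so it has a neighbourhood missing the corresponding
  inside.\<close>

lemma crosscut_separates_complex:
  fixes c g :: "real \<Rightarrow> complex"
  assumes jb: "jordan_boundary c U"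
    and abm: "0 < a" "a < m" "m < b" "b < 1"
    and g: "arc g" "pathstart g = c a" "pathfinish g = c b"
      "path_image g \<subseteq> U \<union> {c a, c b}"
  obtains e where "e > 0"
    "\<And>p q. \<lbrakk>p \<in> ball (c m) e; q \<in> ball (c 0) e\<rbrakk> \<Longrightarrow> \<not> connected_component (U - path_image g) p q"
proof -
  have c: "simple_path c" "pathfinish c = pathstart c" "open U"
    using jb by (auto simp: jordan_boundary_def)
  have U: "U = inside (path_image c)" and dj: "U \<inter> path_image c = {}"
    using jordan_boundary_inside[OF jb] jordan_boundary_disjoint[OF jb] by auto
  have inj: "s = t" if "c s = c t" "s \<in> {0..1}" "t \<in> {0<..<1}" for s t
    using simple_path_eqD c that by blast
  have c01: "c 0 = c 1" using c by (simp add: pathstart_def pathfinish_def)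
  have cab: "c a \<noteq> c b" using inj[of a b] abm by auto
  define c1 where "c1 = subpath a b c"
  \<comment> \<open>This arc passes through the base point \<open>c 0 = c 1\<close>. It is reversed
    into \<open>c2\<close> because the splitting theorem wants all three arcs to run from
    \<open>c a\<close> to \<open>c b\<close>.\<close>
  define d where "d = subpath b 1 c +++ subpath 0 a c"
  define c2 where "c2 = reversepath d"
  have im1: "path_image c1 = c ` {a..b}"
    using abm by (simp add: c1_def path_image_subpath)
  have imd: "path_image d = c ` {b..1} \<union> c ` {0..a}"
    unfolding d_def using abm c01 by (subst path_image_join) (auto simp: path_image_subpath)
  have im2: "path_image c2 = c ` {b..1} \<union> c ` {0..a}"
    using imd by (simp add: c2_def)
  have arc1: "arc c1"
    unfolding c1_def using c abm cab by (intro arc_simple_path_subpath) auto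
  have "arc d"
    unfolding d_def
  proof (rule arc_join)
    show "arc (subpath b 1 c)"
      using c abm inj[of 1 b] by (intro arc_simple_path_subpath) auto
    show "arc (subpath 0 a c)"
      using c abm inj[of 0 a] by (intro arc_simple_path_subpath) auto
    show "pathfinish (subpath b 1 c) = pathstart (subpath 0 a c)"
      using c01 by simp
    show "path_image (subpath b 1 c) \<inter> path_image (subpath 0 a c) \<subseteq> {pathstart (subpath 0 a c)}"
    proof -
      have "c s = c 0" if "c s = c t" "s \<in> {b..1}" "t \<in> {0..a}" for s t
        using inj[of s t] that abm by (cases "t = 0") auto
      then show ?thesis using abm by (auto simp: path_image_subpath)
    qed
  qed
  then have arc2: "arc c2" by (simp add: c2_def arc_reversepath)
  have ends: "pathstart c1 = c a" "pathfinish c1 = c b" "pathstart c2 = c a" "pathfinish c2 = c b"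
    by (simp_all add: c1_def c2_def d_def)
  have un: "path_image c1 \<union> path_image c2 = path_image c"
  proof -
    have iv: "{0..1} = {a..b} \<union> {b..1} \<union> {0..a}" using abm by auto
    show ?thesis unfolding im1 im2 path_image_def[of c] iv by (simp add: image_Un Un_assoc)
  qed
  have int12: "path_image c1 \<inter> path_image c2 = {c a, c b}"
  proof
    have "s = a \<or> s = b" if "c s = c t" "s \<in> {a..b}" "t \<in> {b..1} \<union> {0..a}" for s t
      using inj[of t s] that abm by auto
    then have "c s \<in> {c a, c b}" if "c s = c t" "s \<in> {a..b}" "t \<in> {b..1} \<union> {0..a}" for s t
      using that by blast
    then show "path_image c1 \<inter> path_image c2 \<subseteq> {c a, c b}"
      unfolding im1 im2 image_Un[symmetric] by (smt (verit) IntE imageE subsetI)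
  qed (use abm in \<open>auto simp: im1 im2\<close>)
  have gends: "c a \<in> path_image g" "c b \<in> path_image g"
    using g by (metis pathstart_in_path_image, metis pathfinish_in_path_image)
  have int1g: "path_image c1 \<inter> path_image g = {c a, c b}"
    and int2g: "path_image c2 \<inter> path_image g = {c a, c b}"
    using gends g(4) dj un int12 by auto
  \<comment> \<open>The splitting theorem needs the third arc to enter the inside. The midpoint of
    \<open>g\<close> does, being different from both ends.\<close>
  have "path_image g \<inter> U \<noteq> {}"
  proof -
    have "g (1/2) \<noteq> g 0" "g (1/2) \<noteq> g 1"
      using g(1) inj_onD[of g "{0..1}" "1/2"] by (fastforce simp: arc_def)+
    moreover have "g (1/2) \<in> path_image g" by (auto simp: path_image_def)
    ultimately show ?thesis
      using g by (auto simp: pathstart_def pathfinish_def)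
  qed
  then have ne: "path_image g \<inter> inside (path_image c1 \<union> path_image c2) \<noteq> {}"
    using un U by auto
  define I1 where "I1 = inside (path_image c1 \<union> path_image g)"
  define I2 where "I2 = inside (path_image c2 \<union> path_image g)"
  have I: "I1 \<inter> I2 = {}" "I1 \<union> I2 \<union> (path_image g - {c a, c b}) = U"
  proof -
    note split = split_inside_simple_closed_curve[of c1 "c a" "c b" c2 g]
    show "I1 \<inter> I2 = {}" "I1 \<union> I2 \<union> (path_image g - {c a, c b}) = U"
      using split arc1 arc2 g ends cab int12 int1g int2g ne
      unfolding I1_def I2_def U un[symmetric]
      by (auto dest!: arc_imp_simple_path)
  qed
  have cl1: "closed (path_image c1 \<union> path_image g)" and cl2: "closed (path_image c2 \<union> path_image g)"
    using arc1 arc2 g by (auto intro: closed_arc_image)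
  have op: "open I1" "open I2"
    unfolding I1_def I2_def using cl1 cl2 by (auto intro: open_inside)
  have cmU: "c m \<notin> U" "c 0 \<notin> U" using dj abm by (auto simp: path_image_def)
  have "c s \<noteq> c m" if "s \<in> {b..1} \<union> {0..a}" for s
    using inj[of s m] that abm by auto
  then have "c m \<notin> path_image c2"
    unfolding im2 image_Un[symmetric] by (metis imageE)
  moreover from this have "c m \<notin> path_image g"
    using cmU g(4) int12 by blast
  ultimately have m: "c m \<notin> closure I2"
    using closure_inside_subset[OF cl2] cmU I unfolding I2_def by auto
  have "c 0 \<noteq> c s" if "s \<in> {a..b}" for s
    using inj[of 0 s] that abm by auto
  then have "c 0 \<notin> path_image c1"
    unfolding im1 by (metis imageE)
  moreover from this have "c 0 \<notin> path_image g"
    using cmU g(4) int12 by blast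
  ultimately have z: "c 0 \<notin> closure I1"
    using closure_inside_subset[OF cl1] cmU I unfolding I1_def by auto
  have "open (- closure I2)" "open (- closure I1)" by auto
  then obtain e1 e2 where e: "e1 > 0" "ball (c m) e1 \<subseteq> - closure I2"
     "e2 > 0" "ball (c 0) e2 \<subseteq> - closure I1"
    using m z by (meson ComplI open_contains_ball)
  show thesis
  proof (rule that[of "min e1 e2"])
    show "min e1 e2 > 0" using e by simp
    fix p q assume p: "p \<in> ball (c m) (min e1 e2)" and q: "q \<in> ball (c 0) (min e1 e2)"
    have pq: "p \<notin> I2" "q \<notin> I1" using p q e closure_subset by fastforce+
    show "\<not> connected_component (U - path_image g) p q"
    proof
      assume "connected_component (U - path_image g) p q"
      then obtain T where T: "connected T" "T \<subseteq> U - path_image g" "p \<in> T" "q \<in> T"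
        unfolding connected_component_def by blast
      have "T \<subseteq> I1 \<union> I2" using T I by auto
      then have "p \<in> I1" "q \<in> I2" using T pq by auto
      then show False
        using connectedD[OF T(1) op] T I \<open>T \<subseteq> I1 \<union> I2\<close> by auto
    qed
  qed
qed

section \<open>Transfer from the complex plane to \<open>real^2\<close>\<close>

text \<open>The Jordan curve theorem and its relatives are in the library for \<^typ>\<open>complex\<close> only.\<close>

lemma plane_isometry:
  "\<exists>(f :: real^2 \<Rightarrow> complex) h. linear f \<and> linear h \<and> (\<forall>x. norm (f x) = norm x) \<and>
     (\<forall>x. h (f x) = x) \<and> (\<forall>y. f (h y) = y)"
  by (rule isomorphisms_UNIV_UNIV[where 'M="real^2" and 'N=complex]) auto

lemma jordan_boundary_linear_image:
  fixes f :: "'a::euclidean_space \<Rightarrow> 'b::euclidean_space"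
  assumes jb: "jordan_boundary c U" and f: "linear f" "bij f"
  shows "jordan_boundary (f \<circ> c) (f ` U)"
proof -
  note jb' = jb[unfolded jordan_boundary_def]
  have inj: "inj f" using f bij_is_inj by blast
  have op: "open (f ` U)"
    using jb' f by (simp add: open_bijective_linear_image_eq)
  have "frontier (f ` U) = closure (f ` U) - f ` U"
    using op by (simp add: frontier_def interior_open)
  also have "\<dots> = f ` closure U - f ` U"
    using f(1) inj by (simp add: closure_injective_linear_image)
  also have "\<dots> = f ` frontier U"
    using jb' inj by (simp add: frontier_def interior_open image_set_diff)
  finally have "frontier (f ` U) = path_image (f \<circ> c)"
    using jb' by (simp add: path_image_compose)
  then show ?thesis
    using jb' op f inj
    by (auto simp: jordan_boundary_def simple_path_linear_image_eq pathstart_compose pathfinish_compose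
        intro!: connected_linear_image bounded_linear_image linear_conv_bounded_linear[THEN iffD1])
qed

text \<open>The map \<open>f\<close> is an isometry, so the radius \<open>e\<close> found in
  \<open>complex\<close> serves unchanged, and a homeomorphism carries connected components
  along.\<close>

lemma crosscut_separates:
  fixes c g :: "real \<Rightarrow> real^2"
  assumes jb: "jordan_boundary c U"
    and abm: "0 < a" "a < m" "m < b" "b < 1"
    and g: "arc g" "pathstart g = c a" "pathfinish g = c b"
      "path_image g \<subseteq> U \<union> {c a, c b}"
  obtains e where "e > 0"
    "\<And>p q. \<lbrakk>p \<in> ball (c m) e; q \<in> ball (c 0) e\<rbrakk> \<Longrightarrow> \<not> connected_component (U - path_image g) p q"
proof -
  obtain f :: "real^2 \<Rightarrow> complex" and h where fh: "linear f" "linear h"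
    "\<And>x. norm (f x) = norm x" "\<And>x. h (f x) = x" "\<And>y. f (h y) = y"
    using plane_isometry by blast
  have bij: "bij f" by (rule o_bij[of h]) (use fh in auto)
  then have inj: "inj f" using bij_is_inj by blast
  have dist: "dist (f x) (f y) = dist x y" for x y
    using fh by (metis dist_norm linear_diff)
  have "arc (f \<circ> g)" using g(1) fh(1) inj by (simp add: arc_linear_image_eq)
  then obtain e where e: "e > 0" "\<And>p q. \<lbrakk>p \<in> ball ((f \<circ> c) m) e; q \<in> ball ((f \<circ> c) 0) e\<rbrakk>
      \<Longrightarrow> \<not> connected_component (f ` U - path_image (f \<circ> g)) p q"
    using crosscut_separates_complex[OF jordan_boundary_linear_image[OF jb fh(1) bij] abm, of "f \<circ> g"] g
    by (simp add: pathstart_compose pathfinish_compose path_image_compose) blast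
  show thesis
  proof (rule that[OF e(1)])
    fix p q assume pq: "p \<in> ball (c m) e" "q \<in> ball (c 0) e"
    have "homeomorphism A (f ` A) f h" for A
      using fh by (auto simp: homeomorphism_def linear_conv_bounded_linear image_image intro!: linear_continuous_on)
    then have "homeomorphism (U - path_image g) (f ` U - path_image (f \<circ> g)) f h"
      using inj by (metis image_set_diff path_image_compose)
    then show "\<not> connected_component (U - path_image g) p q"
      using e(2)[of "f p" "f q"] pq dist by (auto dest: connected_component_homeomorphismI)
  qed
qed

lemma Janiszewski_plane:
  fixes p q :: "real^2"
  assumes "compact S" "closed T" "connected (S \<inter> T)"
    and "connected_component (- S) p q" "connected_component (- T) p q"
  shows "connected_component (- (S \<union> T)) p q"
proof -
  obtain f :: "real^2 \<Rightarrow> complex" and h where fh: "linear f" "linear h"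
    "\<And>x. norm (f x) = norm x" "\<And>x. h (f x) = x" "\<And>y. f (h y) = y"
    using plane_isometry by blast
  have bij: "bij f" by (rule o_bij[of h]) (use fh in auto)
  then have inj: "inj f" using bij_is_inj by blast
  have "homeomorphism A (f ` A) f h" for A
    using fh by (auto simp: homeomorphism_def linear_conv_bounded_linear image_image intro!: linear_continuous_on)
  then have hom: "homeomorphism (- A) (- f ` A) f h" for A
    using bij by (metis bij_image_Compl_eq)
  have "connected_component (- (f ` S \<union> f ` T)) (f p) (f q)"
  proof (rule Janiszewski)
    show "compact (f ` S)" using assms fh by (simp add: compact_continuous_image linear_continuous_on linear_conv_bounded_linear)
    show "closed (f ` T)" using assms fh inj closed_injective_linear_image by blast
    show "connected (f ` S \<inter> f ` T)"
      using assms fh(1) inj by (simp add: connected_linear_image flip: image_Int)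
  qed (use assms hom connected_component_homeomorphismI in blast)+
  then have "connected_component (- (S \<union> T)) (h (f p)) (h (f q))"
    using connected_component_homeomorphismI[OF homeomorphism_symD[OF hom[of "S \<union> T"]]]
    by (simp add: image_Un)
  then show ?thesis using fh by simp
qed

section \<open>Components of a loop with two points removed\<close>

lemma components_eq_two:
  assumes K: "closed K" "closed L" and A: "A = S \<inter> K" and B: "B = S \<inter> L"
    and AB: "A \<noteq> {}" "B \<noteq> {}" "A \<inter> B = {}" "A \<union> B = S"
    and conn: "connected A" "connected B"
  shows "components S = {A, B}"
proof -
  have KL: "K \<inter> L \<inter> S = {}" "S \<subseteq> K \<union> L"
    using AB(3,4) unfolding A B by auto
  \<comment> \<open>Both pieces are traces of closed sets, so a connected subset of \<open>S\<close>
    cannot meet both. Hence each piece, being connected, is maximal.\<close>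
  have sep: "D \<inter> A = {} \<or> D \<inter> B = {}" if D: "connected D" "D \<subseteq> S" for D
  proof -
    have "K \<inter> L \<inter> D = {}" "D \<subseteq> K \<union> L" using KL D(2) by blast+
    then have "K \<inter> D = {} \<or> L \<inter> D = {}"
      using connected_closedD[OF D(1) _ _ K] by blast
    then show ?thesis unfolding A B by blast
  qed
  have sub: "A \<subseteq> S" "B \<subseteq> S" using AB(4) by auto
  have "D = A" if "connected D" "D \<subseteq> S" "A \<subseteq> D" for D
    using sep[OF that(1,2)] that AB(1,4) by blast
  moreover have "D = B" if "connected D" "D \<subseteq> S" "B \<subseteq> D" for D
    using sep[OF that(1,2)] that AB(2,4) by blast
  ultimately have comp: "A \<in> components S" "B \<in> components S"
    unfolding in_components_maximal using sub AB(1,2) conn by auto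
  have "C = A \<or> C = B" if C: "C \<in> components S" for C
  proof -
    have "C \<inter> A \<noteq> {} \<or> C \<inter> B \<noteq> {}"
      using in_components_subset[OF C] in_components_nonempty[OF C] AB(4) by blast
    then show ?thesis using components_eq[OF C] comp by blast
  qed
  then show ?thesis using comp by blast
qed

text \<open>Replaces injectivity, which fails for a loop at its base point: only the actual
  coincidences of values have to be examined.\<close>

lemma image_eq_Int_imageI:
  assumes "A \<subseteq> B" "A \<subseteq> C" "\<And>s t. s \<in> B \<Longrightarrow> t \<in> C \<Longrightarrow> f s = f t \<Longrightarrow> s \<in> A"
  shows "f ` A = f ` B \<inter> f ` C"
proof
  show "f ` B \<inter> f ` C \<subseteq> f ` A"
  proof
    fix z assume "z \<in> f ` B \<inter> f ` C"
    then obtain s t where "z = f s" "s \<in> B" "t \<in> C" "f s = f t" by auto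
    then show "z \<in> f ` A" using assms(3) by blast
  qed
qed (use assms(1,2) in blast)

lemma components_loop_minus_two_points:
  fixes c :: "real \<Rightarrow> 'a::real_normed_vector"
  assumes c: "simple_path c" "pathfinish c = pathstart c" and ab: "0 < a" "a < b" "b < 1"
  shows "components (path_image c - {c a, c b}) = {c ` {a<..<b}, c ` ({0..<a} \<union> {b<..1})}"
proof (rule components_eq_two)
  have cont: "continuous_on {0..1} c"
    using c simple_path_imp_path path_def by blast
  have c01: "c 0 = c 1" using c by (simp add: pathstart_def pathfinish_def)
  have inj: "s = t" if "c s = c t" "s \<in> {0..1}" "t \<in> {0<..<1}" for s t
    using simple_path_eqD c(1) that by blast
  have ne: "c s \<noteq> c t" if "s \<in> {a<..<b}" "t \<in> {0..a} \<union> {b..1}" for s t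
    using inj[of t s] that ab by auto
  have ne_ab: "c s \<noteq> c a" "c s \<noteq> c b" if "s \<in> {0..1} - {a,b}" for s
    using inj[of s a] inj[of s b] that ab by auto
  have "compact (c ` {a..b})" "compact (c ` ({0..a} \<union> {b..1}))"
    using ab by (auto intro!: compact_continuous_image continuous_on_subset[OF cont])
  then show "closed (c ` {a..b})" "closed (c ` ({0..a} \<union> {b..1}))"
    by (auto intro: compact_imp_closed)
  have S: "path_image c - {c a, c b} = c ` ({0..1} - {a,b})"
    using ne_ab by (auto simp: path_image_def)
  have split: "{0..1} - {a,b} = {a<..<b} \<union> ({0..<a} \<union> {b<..1})" using ab by auto
  show "c ` {a<..<b} = (path_image c - {c a, c b}) \<inter> c ` {a..b}"
    unfolding S
  proof (rule image_eq_Int_imageI)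
    fix s t assume st: "s \<in> {0..1} - {a,b}" "t \<in> {a..b}" "c s = c t"
    have "t \<in> {a<..<b}" using ne_ab[OF st(1)] st by (auto simp: less_le)
    then show "s \<in> {a<..<b}" using ne[of t s] st by fastforce
  qed (use ab in auto)
  show "c ` ({0..<a} \<union> {b<..1}) = (path_image c - {c a, c b}) \<inter> c ` ({0..a} \<union> {b..1})"
    unfolding S
  proof (rule image_eq_Int_imageI)
    fix s t assume st: "s \<in> {0..1} - {a,b}" "t \<in> {0..a} \<union> {b..1}" "c s = c t"
    then show "s \<in> {0..<a} \<union> {b<..1}" using ne[of s t] split by blast
  qed (use ab in auto)
  show "c ` {a<..<b} \<noteq> {}" "c ` ({0..<a} \<union> {b<..1}) \<noteq> {}" using ab by auto
  show "c ` {a<..<b} \<inter> c ` ({0..<a} \<union> {b<..1}) = {}"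
  proof (rule equals0I)
    fix z assume "z \<in> c ` {a<..<b} \<inter> c ` ({0..<a} \<union> {b<..1})"
    then obtain s t where "s \<in> {a<..<b}" "t \<in> {0..<a} \<union> {b<..1}" "c s = c t" by blast
    then show False using ne[of s t] by auto
  qed
  show "c ` {a<..<b} \<union> c ` ({0..<a} \<union> {b<..1}) = path_image c - {c a, c b}"
    unfolding S split by (simp add: image_Un)
  show "connected (c ` {a<..<b})"
    using ab by (intro connected_continuous_image continuous_on_subset[OF cont]) auto
  \<comment> \<open>The remaining arc is connected because its two halves meet at the base
    point.\<close>
  have "connected (c ` {0..<a})" "connected (c ` {b<..1})"
    using ab by (auto intro!: connected_continuous_image continuous_on_subset[OF cont])
  moreover have "c 0 \<in> c ` {0..<a}" "c 1 \<in> c ` {b<..1}" using ab by simp_all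
  then have "c ` {0..<a} \<inter> c ` {b<..1} \<noteq> {}" using c01 by auto
  ultimately show "connected (c ` ({0..<a} \<union> {b<..1}))"
    unfolding image_Un by (rule connected_Un)
qed

text \<open>By the Jordan-Brouwer theorem the frontier is the whole curve, and shifting the
  parameter moves the base point to any prescribed boundary point.\<close>

lemma jordan_domain_boundary:
  assumes "jordan_domain \<Omega>" "Q \<in> frontier \<Omega>"
  obtains c where "jordan_boundary c \<Omega>" "c 0 = Q"
proof -
  obtain c where c: "simple_path c" "pathfinish c = pathstart c" "\<Omega> \<in> components (- path_image c)"
    "bounded \<Omega>"
    using assms(1) unfolding jordan_domain_def by blast
  have "path_image c homeomorphic sphere (0::complex) 1"
    using c homeomorphic_simple_path_image_circle by force
  moreover have "sphere (0::complex) 1 homeomorphic sphere (0::real^2) 1"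
    by (simp add: homeomorphic_spheres_gen)
  ultimately have "path_image c homeomorphic sphere (0::real^2) 1"
    using homeomorphic_trans by blast
  then have fr: "frontier \<Omega> = path_image c"
    using c by (intro Jordan_Brouwer_frontier) auto
  then obtain t where t: "t \<in> {0..1}" "c t = Q"
    using assms(2) by (auto simp: path_image_def)
  have "open \<Omega>"
    using c by (metis closed_simple_path_image open_Compl open_components)
  then have "jordan_boundary (shiftpath t c) \<Omega>"
    using c t fr in_components_nonempty[OF c(3)] in_components_connected[OF c(3)]
    by (auto simp: jordan_boundary_def path_image_shiftpath simple_path_shiftpath
        pathstart_shiftpath pathfinish_shiftpath)
  moreover have "shiftpath t c 0 = Q" using t by (simp add: shiftpath_def)
  ultimately show thesis by (rule that)
qed

section \<open>The region and its boundary relative to disks\<close>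

lemma bounded_frontier_subset_ball:
  fixes U :: "(real^2) set"
  assumes "bounded U" "frontier U \<subseteq> ball x R"
  shows "U \<subseteq> ball x R"
proof (rule ccontr)
  assume "\<not> U \<subseteq> ball x R"
  then have "- ball x R \<inter> U \<noteq> {}" by auto
  \<comment> \<open>The exterior of a disk is connected and unbounded: if it met the bounded set
    \<open>U\<close>, it would have to cross the frontier.\<close>
  moreover have "connected (- ball x R)"
    by (rule connected_complement_bounded_convex) auto
  moreover have "\<not> - ball x R \<subseteq> U"
    using assms(1) bounded_subset cobounded_imp_unbounded[of "- ball x R"] by auto
  ultimately show False
    using connected_Int_frontier[of "- ball x R" U] assms(2) by blast
qed

lemma joined_by_arc_inI:
  assumes "open S" "connected_component S p q" "p \<noteq> q"
  shows "joined_by_arc_in S p q"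
proof -
  have "path_component S p q"
    using assms open_path_connected_component[of S p] by simp
  then obtain g where g: "path g" "path_image g \<subseteq> S" "pathstart g = p" "pathfinish g = q"
    unfolding path_component_def by blast
  then show ?thesis
    using path_contains_arc[OF g(1,3,4) assms(3)] unfolding joined_by_arc_in_def
    by (metis order_trans)
qed

text \<open>\<open>\<sigma>\<close> runs from the first to the last parameter at which the curve is
  in \<open>cball x r\<close>; \<open>\<tau>\<close> is the rest, through the far base point. If the
  end points differ, \<open>small\<close> makes one of the two arcs short, and this cannot be the
  one that reaches \<open>c 0\<close>.\<close>

lemma boundary_arc_covering_disk:
  fixes c :: "real \<Rightarrow> real^2"
  assumes jb: "jordan_boundary c U" and far: "R \<le> dist x (c 0)" and R: "r + D < R" "0 \<le> D"
    and small: "\<And>P Q. \<lbrakk>P \<in> frontier U \<inter> cball x r; Q \<in> frontier U \<inter> cball x r; P \<noteq> Q\<rbrakk> \<Longrightarrow>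
      Min (diameter ` components (frontier U - {P, Q})) \<le> D"
  obtains \<sigma> \<tau> where "frontier U = \<sigma> \<union> \<tau>" "compact \<sigma>" "compact \<tau>" "connected \<sigma>" "connected \<tau>"
    "\<sigma> \<subseteq> ball x R" "\<tau> \<inter> ball x r = {}" "frontier U \<inter> cball x r \<subseteq> \<sigma>"
proof -
  have c: "simple_path c" "pathfinish c = pathstart c" and fr: "frontier U = path_image c"
    using jb by (auto simp: jordan_boundary_def)
  have cont: "continuous_on {0..1} c"
    using c simple_path_imp_path path_def by blast
  have c01: "c 0 = c 1" using c by (simp add: pathstart_def pathfinish_def)
  define K where "K = {0..1} \<inter> c -` cball x r"
  have K: "t \<in> K \<longleftrightarrow> 0 \<le> t \<and> t \<le> 1 \<and> dist x (c t) \<le> r" for t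
    by (auto simp: K_def)
  have "closed K"
    unfolding K_def by (intro continuous_closed_preimage[OF cont]) auto
  show thesis
  proof (cases "K = {}")
    case True
    then have "path_image c \<inter> cball x r = {}"
      by (auto simp: K_def path_image_def)
    moreover from this have "path_image c \<inter> ball x r = {}"
      using ball_subset_cball by fastforce
    ultimately show thesis
      using fr c by (intro that[of "{}" "path_image c"])
        (auto simp: compact_simple_path_image connected_simple_path_image)
  next
    case False
    have bdd: "bdd_below K" "bdd_above K" by (auto simp: K_def)
    define a b where "a = Inf K" and "b = Sup K"
    have aK: "a \<in> K" and bK: "b \<in> K"
      unfolding a_def b_def using \<open>closed K\<close> False bdd closed_contains_Inf closed_contains_Sup by auto
    have Kab: "a \<le> t \<and> t \<le> b" if "t \<in> K" for t
      unfolding a_def b_def using that bdd by (auto intro: cInf_lower cSup_upper)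
    have "0 \<notin> K" "1 \<notin> K" using far R c01 by (auto simp: K_def)
    with aK bK have a0: "0 < a" and b1: "b < 1" by (auto simp: K_def less_le)
    have ab: "a \<le> b" using Kab aK by auto
    define \<sigma> \<tau> where "\<sigma> = c ` {a..b}" and "\<tau> = c ` {0..a} \<union> c ` {b..1}"
    \<comment> \<open>The half-open pieces stay at distance at least \<open>r\<close> from
      \<open>x\<close>. This passes to closures, so \<open>c a\<close> and \<open>c b\<close> are
      not in the open disk either.\<close>
    have "continuous_on (closure {0..<a}) c" "continuous_on (closure {b<..1}) c"
      using a0 ab b1 by (auto intro: continuous_on_subset[OF cont])
    then have outa: "c ` {0..<a} \<subseteq> X \<Longrightarrow> closed X \<Longrightarrow> c ` {0..a} \<subseteq> X"
      and outb: "c ` {b<..1} \<subseteq> X \<Longrightarrow> closed X \<Longrightarrow> c ` {b..1} \<subseteq> X" for X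
      using image_closure_subset[of "{0..<a}" c X] image_closure_subset[of "{b<..1}" c X] a0 b1
      by simp_all
    have nK: "r \<le> dist x (c t)" if "t \<in> {0..<a} \<union> {b<..1}" for t
      using Kab[of t] K[of t] that a0 b1 ab by force
    have "c ` {0..<a} \<subseteq> - ball x r" "c ` {b<..1} \<subseteq> - ball x r"
      using nK by force+
    then have "c ` {0..a} \<subseteq> - ball x r" "c ` {b..1} \<subseteq> - ball x r"
      using outa[of "- ball x r"] outb[of "- ball x r"] by (simp_all add: closed_Compl)
    then have \<tau>1: "\<tau> \<inter> ball x r = {}" unfolding \<tau>_def by blast
    have \<sigma>1: "\<sigma> \<subseteq> ball x R"
    proof (cases "a = b")
      \<comment> \<open>\<open>\<sigma>\<close> is a single point; \<open>small\<close> does not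
        apply, since it speaks of two distinct points.\<close>
      case True
      then show ?thesis using aK R by (auto simp: K_def \<sigma>_def)
    next
      case False
      then have ab': "a < b" using ab by simp
      define A B where "A = c ` {a<..<b}" and "B = c ` ({0..<a} \<union> {b<..1})"
      have cab: "c a \<noteq> c b"
        using simple_path_eqD[of c b a] c a0 b1 ab' by auto
      have bd: "bounded A" "bounded B"
        unfolding A_def B_def
        by (rule bounded_subset[OF bounded_simple_path_image[OF c(1)]]; use a0 ab' b1 in \<open>force simp: path_image_def\<close>)+
      have "Min (diameter ` {A, B}) \<le> D"
        using small[of "c a" "c b"] aK bK cab components_loop_minus_two_points[OF c a0 ab' b1] fr
        by (auto simp: A_def B_def K_def path_image_def)
      then have "diameter A \<le> D \<or> diameter B \<le> D" by auto
      \<comment> \<open>The closure of \<open>B\<close> contains \<open>c a\<close>, within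
        \<open>r\<close> of \<open>x\<close>, and \<open>c 0\<close>, at distance at least
        \<open>R\<close> from \<open>x\<close>. By \<open>r + D < R\<close> these are more than
        \<open>D\<close> apart.\<close>
      moreover have "\<not> diameter B \<le> D"
      proof
        assume "diameter B \<le> D"
        have "c ` {0..<a} \<subseteq> B" by (simp add: B_def image_Un)
        then have "c ` {0..a} \<subseteq> closure B"
          using closure_subset by (intro outa) (blast, simp)
        then have "c a \<in> closure B" "c 0 \<in> closure B"
          using a0 by (simp_all add: image_subset_iff)
        then have "dist (c a) (c 0) \<le> D"
          using diameter_bounded_bound[of "closure B" "c a" "c 0"] bd \<open>diameter B \<le> D\<close>
          by (simp add: diameter_closure bounded_closure)
        then show False
          using far R aK dist_triangle[of x "c 0" "c a"] unfolding K by simp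
      qed
      ultimately have dA: "diameter A \<le> D" by simp
      have "continuous_on (closure {a<..<b}) c"
        using a0 ab' b1 by (auto intro: continuous_on_subset[OF cont])
      then have clA: "\<sigma> \<subseteq> closure A"
        using image_closure_subset[of "{a<..<b}" c "closure A"] closure_subset[of A] ab'
        by (simp add: \<sigma>_def A_def)
      have "dist (c a) z \<le> D" if "z \<in> \<sigma>" for z
        using diameter_bounded_bound[of "closure A" "c a" z] bd dA that clA ab'
        by (auto simp: diameter_closure bounded_closure \<sigma>_def subset_iff)
      then have "dist x z < R" if "z \<in> \<sigma>" for z
        using aK R dist_triangle[of x z "c a"] that unfolding K by force
      then show ?thesis by auto
    qed
    have sub: "{a..b} \<subseteq> {0..1}" "{0..a} \<subseteq> {0..1}" "{b..1} \<subseteq> {0..1}"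
      using a0 ab b1 by auto
    have "{0..1} = {a..b} \<union> {0..a} \<union> {b..1}" using a0 ab b1 by auto
    then have un: "path_image c = \<sigma> \<union> \<tau>"
      unfolding path_image_def \<sigma>_def \<tau>_def by (metis image_Un sup_assoc)
    have "compact \<sigma>" "compact \<tau>" "connected \<sigma>"
      unfolding \<sigma>_def \<tau>_def
      by (rule compact_Un | rule compact_continuous_image connected_continuous_image |
          rule continuous_on_subset[OF cont] | rule sub compact_Icc connected_Icc)+
    moreover have "connected \<tau>"
      unfolding \<tau>_def
    proof (rule connected_Un)
      show "connected (c ` {0..a})" "connected (c ` {b..1})"
        by (rule connected_continuous_image continuous_on_subset[OF cont] sub connected_Icc)+
      have "c 0 \<in> c ` {0..a}" "c 1 \<in> c ` {b..1}" using a0 b1 by simp_all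
      then have "c 0 \<in> c ` {0..a} \<inter> c ` {b..1}" using c01 by simp
      then show "c ` {0..a} \<inter> c ` {b..1} \<noteq> {}" by blast
    qed
    moreover have "path_image c \<inter> cball x r \<subseteq> \<sigma>"
      using Kab by (auto simp: K_def path_image_def \<sigma>_def)
    ultimately show thesis
      using that \<tau>1 \<sigma>1 un fr by metis
  qed
qed

subsection \<open>Control functions\<close>

lemma control_function_mono:
  assumes "control_function \<psi>" "0 \<le> s" "s \<le> t"
  shows "\<psi> s \<le> \<psi> t"
  using assms strict_mono_on_imp_mono_on[of "{0..}" \<psi>]
  by (auto simp: control_function_def mono_on_def)

lemma control_function_ge:
  assumes "control_function \<psi>" "0 \<le> s"
  shows "s \<le> \<psi> s"
  using assms by (cases "s = 0") (auto simp: control_function_def)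

text \<open>Take the upper doubling bound of the inverse at the value \<open>\<psi> s\<close> and
  apply the increasing function \<open>\<psi>\<close> to both sides.\<close>

lemma control_function_doubling:
  assumes "control_function \<psi>"
  obtains K where "K \<ge> 1" "\<And>s. 0 \<le> s \<Longrightarrow> 2 * \<psi> s \<le> \<psi> (K * s)"
proof -
  have bij: "bij_betw \<psi> {0..} {0..}" and zero: "\<psi> 0 = 0"
    using assms by (auto simp: control_function_def)
  obtain C where C: "\<And>t. t > 0 \<Longrightarrow> psi_inv \<psi> (2 * t) \<le> C * psi_inv \<psi> t"
    using assms unfolding control_function_def by blast
  \<comment> \<open>The doubling bound holds at positive arguments only, whence the separate case
    \<open>s = 0\<close>. The maximum ensures a factor of at least 1.\<close>
  have "2 * \<psi> s \<le> \<psi> (max 1 C * s)" if "0 \<le> s" for s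
  proof (cases "s = 0")
    case False
    with that have s: "s > 0" by simp
    then have "\<psi> s > 0" using control_function_ge[OF assms, of s] by linarith
    moreover have "psi_inv \<psi> (\<psi> s) = s"
      using bij that by (simp add: psi_inv_def bij_betw_def)
    ultimately have "psi_inv \<psi> (2 * \<psi> s) \<le> C * s" using C[of "\<psi> s"] by simp
    also have "\<dots> \<le> max 1 C * s" using s by (intro mult_right_mono) auto
    finally have le: "psi_inv \<psi> (2 * \<psi> s) \<le> max 1 C * s" .
    have "2 * \<psi> s \<in> \<psi> ` {0..}"
      using bij \<open>\<psi> s > 0\<close> by (auto simp: bij_betw_def)
    then have "\<psi> (psi_inv \<psi> (2 * \<psi> s)) = 2 * \<psi> s" "psi_inv \<psi> (2 * \<psi> s) \<in> {0..}"
      unfolding psi_inv_def by (rule f_inv_into_f, rule inv_into_into)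
    then show ?thesis using control_function_mono[OF assms _ le] by simp
  qed (simp add: zero)
  then show thesis by (intro that[of "max 1 C"]) auto
qed

text \<open>Local connectivity involves the inverse of the rescaled function. It is evaluated at
  radii written as \<open>\<psi> (C * s)\<close>, and by the next lemma every positive radius has
  this form.\<close>

lemma psi_inv_rescaled:
  assumes "control_function \<psi>" "C \<ge> 1" "0 \<le> s"
  shows "psi_inv (\<lambda>t. \<psi> (C * t)) (\<psi> (C * s)) = s"
proof -
  have "inj_on (\<lambda>t. \<psi> (C * t)) {0..}"
  proof (rule inj_onI)
    fix u v assume "u \<in> {0..}" "v \<in> {0..}" "\<psi> (C * u) = \<psi> (C * v)"
    then show "u = v"
      using assms inj_onD[of \<psi> "{0..}" "C * u" "C * v"]
      by (auto simp: control_function_def bij_betw_def)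
  qed
  then show ?thesis
    unfolding psi_inv_def using assms(3) inv_into_f_f[of "\<lambda>t. \<psi> (C * t)" "{0..}" s] by simp
qed

lemma rescaled_control_surj:
  assumes "control_function \<psi>" "C \<ge> 1" "0 < r"
  obtains s where "s > 0" "\<psi> (C * s) = r"
proof -
  have "r \<in> \<psi> ` {0..}" and zero: "\<psi> 0 = 0"
    using assms by (auto simp: control_function_def bij_betw_def)
  then obtain u where u: "u \<ge> 0" "\<psi> u = r" by auto
  then have "u \<noteq> 0" using zero assms(3) by auto
  then show thesis using u assms(2) by (intro that[of "u / C"]) auto
qed

subsection \<open>The three point property implies local connectivity\<close>

lemma jordan_domain_region:
  assumes "jordan_domain \<Omega>"
  shows "open \<Omega>" "connected \<Omega>" "bounded \<Omega>"
  using assms unfolding jordan_domain_def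
  by (metis closed_simple_path_image open_Compl open_components,
      metis in_components_connected, metis)

lemma three_point_join_in_disk:
  assumes jd: "jordan_domain \<Omega>" and R: "r + D < R" "0 \<le> D" "0 < r"
    and small: "\<And>P Q. \<lbrakk>P \<in> frontier \<Omega> \<inter> cball x r; Q \<in> frontier \<Omega> \<inter> cball x r; P \<noteq> Q\<rbrakk> \<Longrightarrow>
      Min (diameter ` components (frontier \<Omega> - {P, Q})) \<le> D"
    and pq: "p \<in> ball x r \<inter> \<Omega>" "q \<in> ball x r \<inter> \<Omega>" "p \<noteq> q"
  shows "joined_by_arc_in (ball x R \<inter> \<Omega>) p q"
proof -
  have \<Omega>: "open \<Omega>" "connected \<Omega>" "bounded \<Omega>"
    using jordan_domain_region[OF jd] by auto
  have disj: "\<Omega> \<inter> frontier \<Omega> = {}" using \<Omega>(1) frontier_disjoint_eq by blast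
  have conn: "connected_component \<Omega> p q"
    using \<Omega>(2) pq by (auto simp: connected_component_def)
  \<comment> \<open>A boundary inside the large disk keeps all of \<open>\<Omega>\<close> there.
    Otherwise a boundary point off the disk serves as base point.\<close>
  have "connected_component (ball x R \<inter> \<Omega>) p q"
  proof (cases "frontier \<Omega> \<subseteq> ball x R")
    case True
    then have "ball x R \<inter> \<Omega> = \<Omega>" using bounded_frontier_subset_ball \<Omega>(3) by blast
    then show ?thesis using conn by simp
  next
    case False
    then obtain Q where Q: "Q \<in> frontier \<Omega>" "Q \<notin> ball x R" by blast
    obtain c where c: "jordan_boundary c \<Omega>" "c 0 = Q"
      using jordan_domain_boundary[OF jd Q(1)] .
    have far: "R \<le> dist x (c 0)" using c Q by simp
    obtain \<sigma> \<tau> where \<sigma>: "frontier \<Omega> = \<sigma> \<union> \<tau>" "compact \<tau>" "connected \<tau>" "\<sigma> \<subseteq> ball x R"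
      "\<tau> \<inter> ball x r = {}"
      by (rule boundary_arc_covering_disk[OF c(1) far R(1,2)]) (use small in blast)+
    \<comment> \<open>\<open>\<sigma>\<close> lies in the open disk, so the circle meets the
      boundary only in points of \<open>\<tau>\<close>.\<close>
    define T where "T = sphere x R \<union> \<tau>"
    have ST: "frontier \<Omega> \<inter> T = \<tau>" unfolding T_def using \<sigma>(1,4) by auto
    have "connected_component (- (frontier \<Omega> \<union> T)) p q"
    proof (rule Janiszewski_plane)
      show "compact (frontier \<Omega>)" using \<Omega>(3) by (rule compact_frontier_bounded)
      show "closed T" unfolding T_def using \<sigma>(2) by (auto intro: compact_imp_closed)
      show "connected (frontier \<Omega> \<inter> T)" using ST \<sigma>(3) by simp
      show "connected_component (- frontier \<Omega>) p q"
        using conn disj connected_component_of_subset[of \<Omega> p q] by blast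
      have "ball x r \<subseteq> - T" unfolding T_def using \<sigma>(5) R by auto
      then show "connected_component (- T) p q"
        using pq connected_ball[of x r] unfolding connected_component_def by blast
    qed
    then obtain X where X: "connected X" "X \<subseteq> - (frontier \<Omega> \<union> T)" "p \<in> X" "q \<in> X"
      unfolding connected_component_def by blast
    \<comment> \<open>\<open>X\<close> misses both the boundary and the circle, so it can leave
      neither \<open>\<Omega>\<close> nor the disk.\<close>
    have "X \<subseteq> \<Omega>" using connected_Int_frontier[of X \<Omega>] X pq by blast
    moreover have "X \<subseteq> ball x R"
    proof (rule ccontr)
      assume "\<not> X \<subseteq> ball x R"
      then have "X \<inter> frontier (ball x R) \<noteq> {}"
        using X pq R by (intro connected_Int_frontier) auto
      then show False using X(2) R by (auto simp: T_def)
    qed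
    ultimately show ?thesis using X unfolding connected_component_def by blast
  qed
  then show ?thesis using \<Omega>(1) pq by (intro joined_by_arc_inI) auto
qed

lemma three_point_join_off_disk:
  assumes jd: "jordan_domain \<Omega>" and R: "r + D < R" "0 \<le> D"
    and small: "\<And>P Q. \<lbrakk>P \<in> frontier \<Omega> \<inter> cball x r; Q \<in> frontier \<Omega> \<inter> cball x r; P \<noteq> Q\<rbrakk> \<Longrightarrow>
      Min (diameter ` components (frontier \<Omega> - {P, Q})) \<le> D"
    and pq: "p \<in> \<Omega> - ball x R" "q \<in> \<Omega> - ball x R" "p \<noteq> q"
  shows "joined_by_arc_in (\<Omega> - cball x r) p q"
proof -
  have \<Omega>: "open \<Omega>" "connected \<Omega>" "bounded \<Omega>"
    using jordan_domain_region[OF jd] by auto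
  have disj: "\<Omega> \<inter> frontier \<Omega> = {}" using \<Omega>(1) frontier_disjoint_eq by blast
  obtain Q where Q: "Q \<in> frontier \<Omega>" "Q \<notin> ball x R"
    using bounded_frontier_subset_ball[OF \<Omega>(3)] pq by blast
  obtain c where c: "jordan_boundary c \<Omega>" "c 0 = Q"
    using jordan_domain_boundary[OF jd Q(1)] .
  have far: "R \<le> dist x (c 0)" using c Q by simp
  obtain \<sigma> \<tau> where \<sigma>: "frontier \<Omega> = \<sigma> \<union> \<tau>" "compact \<sigma>" "connected \<sigma>" "\<sigma> \<subseteq> ball x R"
    "frontier \<Omega> \<inter> cball x r \<subseteq> \<sigma>"
    by (rule boundary_arc_covering_disk[OF c(1) far R(1,2)]) (use small in blast)+
  \<comment> \<open>Every boundary point in the closed disk is on \<open>\<sigma>\<close>, so adding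
    the disk to \<open>\<sigma>\<close> creates no further common points.\<close>
  define T where "T = cball x r \<union> \<sigma>"
  have ST: "frontier \<Omega> \<inter> T = \<sigma>" unfolding T_def using \<sigma>(1,5) by blast
  have "connected_component (- (frontier \<Omega> \<union> T)) p q"
  proof (rule Janiszewski_plane)
    show "compact (frontier \<Omega>)" using \<Omega>(3) by (rule compact_frontier_bounded)
    show "closed T" unfolding T_def using \<sigma>(2) by (auto intro: compact_imp_closed)
    show "connected (frontier \<Omega> \<inter> T)" using ST \<sigma>(3) by simp
    have "connected_component \<Omega> p q"
      using \<Omega>(2) pq by (auto simp: connected_component_def)
    then show "connected_component (- frontier \<Omega>) p q"
      using disj connected_component_of_subset[of \<Omega> p q] by blast
    have "cball x r \<subseteq> ball x R" using R by auto
    then have "- ball x R \<subseteq> - T" unfolding T_def using \<sigma>(4) by blast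
    moreover have "connected (- ball x R)"
      by (rule connected_complement_bounded_convex) auto
    ultimately show "connected_component (- T) p q"
      using pq unfolding connected_component_def by blast
  qed
  then obtain X where X: "connected X" "X \<subseteq> - (frontier \<Omega> \<union> T)" "p \<in> X" "q \<in> X"
    unfolding connected_component_def by blast
  have "X \<subseteq> \<Omega>" using connected_Int_frontier[of X \<Omega>] X pq by blast
  then have "connected_component (\<Omega> - cball x r) p q"
    using X unfolding connected_component_def T_def by blast
  then show ?thesis using \<Omega>(1) pq by (intro joined_by_arc_inI) auto
qed

lemma three_point_imp_locally_connected:
  assumes jd: "jordan_domain \<Omega>" and \<psi>: "control_function \<psi>"
    and tp: "three_point_property \<psi> \<Omega>"
  shows "\<exists>C\<ge>1. psi_inv_locally_connected (\<lambda>t. \<psi> (C * t)) \<Omega>"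
proof -
  obtain B where B: "B \<ge> 1" "\<And>P Q. \<lbrakk>P \<in> frontier \<Omega>; Q \<in> frontier \<Omega>; P \<noteq> Q\<rbrakk> \<Longrightarrow>
      Min (diameter ` components (frontier \<Omega> - {P, Q})) \<le> \<psi> (B * dist P Q)"
    using tp unfolding three_point_property_def by blast
  obtain K where K: "K \<ge> 1" "\<And>s. 0 \<le> s \<Longrightarrow> 2 * \<psi> s \<le> \<psi> (K * s)"
    by (rule control_function_doubling[OF \<psi>]) blast
  \<comment> \<open>Points of \<open>cball x r\<close> are at most \<open>2 * r\<close> apart, so
    \<open>D = \<psi> (2 * B * r)\<close> bounds the smaller arc. Since \<open>r < D\<close>, it
    suffices that \<open>2 * D \<le> R\<close>; the factor \<open>K\<close> achieves this for
    \<open>R = \<psi> (C * r)\<close>.\<close>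
  define C where "C = K * (2 * B)"
  have "1 * 1 \<le> C" unfolding C_def using K B by (intro mult_mono) auto
  then have C: "C \<ge> 1" by simp
  have R: "r + \<psi> (2 * B * r) < \<psi> (C * r)" if "r > 0" for r
  proof -
    have "1 * r \<le> B * r" using that B by (intro mult_right_mono) auto
    then have "r < 2 * B * r" using that by linarith
    also have "\<dots> \<le> \<psi> (2 * B * r)" using that B by (intro control_function_ge[OF \<psi>]) auto
    finally show ?thesis using K(2)[of "2 * B * r"] that B by (simp add: C_def mult.assoc)
  qed
  have D: "0 \<le> \<psi> (2 * B * r)" if "r > 0" for r
    using control_function_ge[OF \<psi>, of "2 * B * r"] that B by (smt (verit) mult_nonneg_nonneg)
  have small: "Min (diameter ` components (frontier \<Omega> - {P, Q})) \<le> \<psi> (2 * B * r)"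
    if "P \<in> frontier \<Omega> \<inter> cball x r" "Q \<in> frontier \<Omega> \<inter> cball x r" "P \<noteq> Q" for P Q x r
  proof -
    have "dist P Q \<le> 2 * r" using that dist_triangle3[of P Q x] by simp
    then have "B * dist P Q \<le> 2 * B * r" using B by (simp add: mult.assoc mult.left_commute)
    then have "\<psi> (B * dist P Q) \<le> \<psi> (2 * B * r)"
      using B by (intro control_function_mono[OF \<psi>]) auto
    then show ?thesis using B(2)[of P Q] that by simp
  qed
  have "psi_inv_locally_connected (\<lambda>t. \<psi> (C * t)) \<Omega>"
    unfolding psi_inv_locally_connected_def
  proof (intro allI impI conjI ballI)
    fix x :: "real^2" and r :: real and p q
    assume r: "r > 0" and pq: "p \<in> ball x r \<inter> \<Omega>" "q \<in> ball x r \<inter> \<Omega>" "p \<noteq> q"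
    show "joined_by_arc_in (ball x (\<psi> (C * r)) \<inter> \<Omega>) p q"
      by (rule three_point_join_in_disk[OF jd R[OF r] D[OF r] r small pq])
  next
    fix x :: "real^2" and r :: real and p q
    assume r: "r > 0" and pq: "p \<in> \<Omega> - ball x r" "q \<in> \<Omega> - ball x r" "p \<noteq> q"
    \<comment> \<open>In (ii) the given \<open>r\<close> is the large radius, and the small one is
      its inverse value \<open>s\<close>.\<close>
    obtain s where s: "s > 0" "\<psi> (C * s) = r"
      using rescaled_control_surj[OF \<psi> C r] .
    have inv: "psi_inv (\<lambda>t. \<psi> (C * t)) r = s"
      using psi_inv_rescaled[OF \<psi> C, of s] s by simp
    have "joined_by_arc_in (\<Omega> - cball x s) p q"
      using R[OF s(1)] s pq
      by (intro three_point_join_off_disk[OF jd _ D[OF s(1)] small, where R = r]) auto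
    moreover have "\<Omega> - cball x s \<subseteq> \<Omega> - ball x s" by auto
    ultimately show "joined_by_arc_in (\<Omega> - ball x (psi_inv (\<lambda>t. \<psi> (C * t)) r)) p q"
      unfolding inv joined_by_arc_in_def by blast
  qed
  then show ?thesis using C by blast
qed

subsection \<open>Local connectivity implies the three point property\<close>

text \<open>The parameters at distance at least \<open>\<eta>\<close> from \<open>a\<close> have a
  compact image that misses \<open>c a\<close>, hence misses a disk around it. An interior
  \<open>a\<close> is asked for because the base point of a closed curve has two parameters.\<close>

lemma loop_inverse_continuous:
  fixes c :: "real \<Rightarrow> 'a::real_normed_vector"
  assumes c: "simple_path c" and a: "0 < a" "a < 1" and "0 < \<eta>"
  obtains \<delta> where "0 < \<delta>" "\<And>t. t \<in> {0..1} \<Longrightarrow> dist (c a) (c t) < \<delta> \<Longrightarrow> dist a t < \<eta>"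
proof -
  have cont: "continuous_on {0..1} c"
    using c simple_path_imp_path path_def by blast
  define K where "K = c ` ({0..1} - ball a \<eta>)"
  have "compact K"
    unfolding K_def by (intro compact_continuous_image continuous_on_subset[OF cont] compact_diff) auto
  then have "open (- K)" by (simp add: compact_imp_closed open_Compl)
  moreover have "c t \<noteq> c a" if "t \<in> {0..1} - ball a \<eta>" for t
    using simple_path_eqD[OF c, of t a] that a \<open>0 < \<eta>\<close> by auto
  then have "c a \<in> - K" unfolding K_def by (metis ComplI imageE)
  ultimately obtain \<delta> where "\<delta> > 0" "ball (c a) \<delta> \<subseteq> - K"
    by (meson open_contains_ball)
  then show thesis
    by (intro that[of \<delta>]) (force simp: K_def subset_iff)+
qed

text \<open>The first boundary point \<open>c a'\<close> on a segment from a nearby point of \<open>U\<close> to \<open>c a\<close> is accessible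
  from \<open>U\<close>, which \<open>c a\<close> itself need not be along a segment.\<close>

lemma accessible_near:
  fixes c :: "real \<Rightarrow> 'a::real_normed_vector"
  assumes jb: "jordan_boundary c U" and a: "0 \<le> l" "l < a" "a < u" "u \<le> 1"
    and V: "open V" "c a \<in> V"
  obtains a' h where "l < a'" "a' < u" "c ` closed_segment a a' \<subseteq> V"
    "path h" "pathstart h \<in> U" "pathfinish h = c a'" "path_image h \<subseteq> V" "path_image h \<subseteq> U \<union> {c a'}"
proof -
  have c: "simple_path c" and fr: "frontier U = path_image c" and "open U"
    using jb by (auto simp: jordan_boundary_def)
  have cont: "continuous_on {0..1} c"
    using c simple_path_imp_path path_def by blast
  obtain \<epsilon> where \<epsilon>: "\<epsilon> > 0" "ball (c a) \<epsilon> \<subseteq> V"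
    using V by (meson open_contains_ball)
  obtain \<eta>0 where \<eta>0: "\<eta>0 > 0" "\<And>t. t \<in> {0..1} \<Longrightarrow> dist t a < \<eta>0 \<Longrightarrow> dist (c t) (c a) < \<epsilon>"
    using cont[unfolded continuous_on_iff, rule_format, of a \<epsilon>] a \<epsilon>(1) by auto
  \<comment> \<open>Parameters within \<open>\<eta>\<close> of \<open>a\<close> stay between
    \<open>l\<close> and \<open>u\<close> and are mapped into \<open>V\<close>. Boundary points
    within \<open>\<delta>0\<close> of \<open>c a\<close> have such parameters.\<close>
  define \<eta> where "\<eta> = min \<eta>0 (min (a - l) (u - a))"
  have \<eta>: "\<eta> > 0" "\<eta> \<le> \<eta>0" "\<eta> \<le> a - l" "\<eta> \<le> u - a" using \<eta>0 a by (auto simp: \<eta>_def)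
  obtain \<delta>0 where \<delta>0: "0 < \<delta>0" "\<And>t. t \<in> {0..1} \<Longrightarrow> dist (c a) (c t) < \<delta>0 \<Longrightarrow> dist a t < \<eta>"
    by (rule loop_inverse_continuous[OF c, of a \<eta>]) (use a \<eta> in auto)
  define \<delta> where "\<delta> = min \<delta>0 \<epsilon>"
  have "c a \<in> frontier U" using fr a by (auto simp: path_image_def)
  then have "c a \<in> closure U" "c a \<notin> U" using \<open>open U\<close> by (auto simp: frontier_def interior_open)
  moreover have "\<delta> > 0" using \<delta>0 \<epsilon> by (simp add: \<delta>_def)
  ultimately obtain p where p: "p \<in> U" "dist p (c a) < \<delta>"
    using closure_approachable by blast
  have seg: "closed_segment p (c a) \<subseteq> ball (c a) \<delta>"
    using p \<open>\<delta> > 0\<close> by (intro closed_segment_subset) (auto simp: dist_commute)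
  obtain h where h: "path h" "pathstart h = p" "path_image h \<subseteq> closed_segment p (c a)"
    "path_image h - {pathfinish h} \<subseteq> interior U" "pathfinish h \<in> frontier U"
    using exists_path_subpath_to_frontier[of "linepath p (c a)" U] p \<open>c a \<notin> U\<close> closure_subset[of U]
    by auto
  obtain a' where a': "a' \<in> {0..1}" "pathfinish h = c a'"
    using h(5) fr by (auto simp: path_image_def)
  have "dist (c a) (c a') < \<delta>0"
    using h(3) seg a'(2) pathfinish_in_path_image[of h] by (auto simp: \<delta>_def subset_iff)
  then have d: "dist a a' < \<eta>" using \<delta>0(2) a'(1) by blast
  have "c t \<in> V" if "t \<in> closed_segment a a'" for t
  proof -
    have "t \<in> {0..1}" using that a a'(1) by (auto simp: closed_segment_eq_real_ivl split: if_splits)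
    moreover have "dist t a < \<eta>0"
      using that d \<eta>(2) by (auto simp: closed_segment_eq_real_ivl dist_real_def split: if_splits)
    ultimately have "dist (c t) (c a) < \<epsilon>" using \<eta>0(2) by blast
    then show ?thesis using \<epsilon>(2) by (auto simp: dist_commute)
  qed
  moreover have "ball (c a) \<delta> \<subseteq> V" using \<epsilon>(2) by (auto simp: \<delta>_def)
  ultimately show thesis
    using d \<eta> h a' seg p interior_subset[of U]
    by (intro that[of a' h]) (auto simp: dist_real_def)
qed

text \<open>The two arcs of the loop between \<open>c 0\<close> and \<open>c m\<close> share only
  these points, which the segment avoids. So the segment meets the arcs in disjoint closed sets, and
  a gap between the two gives the required subsegment.\<close>

lemma boundary_subsegment:
  fixes c :: "real \<Rightarrow> 'a::real_normed_vector"
  assumes c: "simple_path c" "pathfinish c = pathstart c"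
    and abm: "0 < a" "a < m" "m < b" "b < 1"
    and avoid: "c 0 \<notin> closed_segment (c a) (c b)" "c m \<notin> closed_segment (c a) (c b)"
  obtains a' b' where "0 < a'" "a' < m" "m < b'" "b' < 1"
    "closed_segment (c a') (c b') \<subseteq> closed_segment (c a) (c b)"
    "open_segment (c a') (c b') \<inter> path_image c = {}"
proof -
  have cont: "continuous_on {0..1} c"
    using c simple_path_imp_path path_def by blast
  have c01: "c 0 = c 1" using c by (simp add: pathstart_def pathfinish_def)
  define l where "l = linepath (c a) (c b)"
  have l: "l t \<in> closed_segment (c a) (c b)" if "t \<in> {0..1}" for t
    using that by (simp add: l_def linepath_in_path)
  define F1 F2 where "F1 = {0..1} \<inter> l -` (c ` {0..m})" and "F2 = {0..1} \<inter> l -` (c ` {m..1})"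
  have "compact (c ` {0..m})" "compact (c ` {m..1})"
    using abm by (auto intro!: compact_continuous_image continuous_on_subset[OF cont])
  then have F: "closed F1" "closed F2"
    unfolding F1_def F2_def l_def
    by (auto intro!: continuous_closed_preimage intro: compact_imp_closed simp del: vimage_image_eq)
  have "c a \<in> c ` {0..m}" "c b \<in> c ` {m..1}" using abm by auto
  then have F01: "0 \<in> F1" "1 \<in> F2"
    by (auto simp: F1_def F2_def l_def linepath_def)
  have F12: "F1 \<inter> F2 = {}"
  proof (rule equals0I)
    fix t assume t: "t \<in> F1 \<inter> F2"
    then obtain s s' where s: "s \<in> {0..m}" "s' \<in> {m..1}" "l t = c s" "l t = c s'"
      by (auto simp: F1_def F2_def)
    have "c s \<noteq> c 0" "c s \<noteq> c m" using l[of t] t s(3) avoid by (auto simp: F1_def)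
    then have "s \<noteq> 0" "s \<noteq> m" by auto
    then have "s' = s" using simple_path_eqD[OF c(1), of s' s] s abm by auto
    then show False using s \<open>s \<noteq> m\<close> by auto
  qed
  define t2 where "t2 = Inf F2"
  have bdd: "bdd_below F2" by (auto simp: F2_def)
  then have t2: "t2 \<in> F2" unfolding t2_def using F F01 closed_contains_Inf by blast
  have t2le: "t2 \<le> t" if "t \<in> F2" for t
    unfolding t2_def using that bdd by (rule cInf_lower)
  \<comment> \<open>\<open>t2\<close> is the first parameter on the second arc and \<open>t1\<close>
    the last one before it on the first arc, so no boundary point lies in between.\<close>
  define G where "G = F1 \<inter> {..t2}"
  have "0 \<in> G" using F01 t2 by (auto simp: G_def F2_def)
  have bdd': "bdd_above G" by (auto simp: G_def)
  define t1 where "t1 = Sup G"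
  have "closed G" unfolding G_def using F by auto
  then have t1: "t1 \<in> G" unfolding t1_def using bdd' \<open>0 \<in> G\<close> closed_contains_Sup by blast
  have t1ge: "t \<le> t1" if "t \<in> G" for t
    unfolding t1_def using that bdd' by (rule cSup_upper)
  have t12: "0 \<le> t1" "t1 < t2" "t2 \<le> 1"
  proof -
    have "t1 \<noteq> t2" using t1 t2 F12 unfolding G_def by blast
    then show "0 \<le> t1" "t1 < t2" "t2 \<le> 1" using t1 t2 by (auto simp: G_def F1_def F2_def)
  qed
  obtain a' where a': "a' \<in> {0..m}" "l t1 = c a'" using t1 by (auto simp: G_def F1_def)
  obtain b' where b': "b' \<in> {m..1}" "l t2 = c b'" using t2 by (auto simp: F2_def)
  have "c a' \<noteq> c 0" "c a' \<noteq> c m" "c b' \<noteq> c m" "c b' \<noteq> c 1"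
    using l[of t1] l[of t2] t12 a' b' avoid c01 by auto
  then have "a' \<noteq> 0" "a' \<noteq> m" "b' \<noteq> m" "b' \<noteq> 1" by auto
  then have "0 < a'" "a' < m" "m < b'" "b' < 1" using a' b' by auto
  moreover have "closed_segment (c a') (c b') \<subseteq> closed_segment (c a) (c b)"
    using l[of t1] l[of t2] t12 a' b' by (simp add: subset_closed_segment)
  moreover have "z \<notin> path_image c" if z: "z \<in> open_segment (c a') (c b')" for z
  proof
    assume zc: "z \<in> path_image c"
    obtain v where v: "0 < v" "v < 1" "z = (1 - v) *\<^sub>R l t1 + v *\<^sub>R l t2"
      using z a' b' by (auto simp: in_segment)
    define t where "t = (1 - v) * t1 + v * t2"
    have zt: "z = l t" unfolding v(3) t_def l_def linepath_def by (simp add: algebra_simps)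
    have "t - t1 = v * (t2 - t1)" "t2 - t = (1 - v) * (t2 - t1)" by (simp_all add: t_def algebra_simps)
    then have tt: "t1 < t" "t < t2" using v t12 by (smt (verit) mult_pos_pos)+
    have "{0..1} = {0..m} \<union> {m..1}" using abm by auto
    then have "z \<in> c ` {0..m} \<or> z \<in> c ` {m..1}" using zc unfolding path_image_def by blast
    then have "t \<in> F1 \<or> t \<in> F2" using zt tt t12 by (auto simp: F1_def F2_def)
    then show False using t2le[of t] t1ge[of t] tt by (auto simp: G_def)
  qed
  ultimately show thesis by (intro that[of a' b']) auto
qed

section \<open>Crosscuts near a disk\<close>

lemma frontier_approach:
  fixes U :: "'a::metric_space set"
  assumes "q \<in> frontier U" "0 < e" "R < dist x q"
  obtains p where "p \<in> U" "p \<in> ball q e" "R < dist x p"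
proof -
  have "open (ball q e \<inter> - cball x R)" by auto
  moreover have "q \<in> ball q e \<inter> - cball x R" using assms by auto
  ultimately have "(ball q e \<inter> - cball x R) \<inter> U \<noteq> {}"
    using assms(1) unfolding frontier_def by (metis DiffD1 IntI empty_iff open_Int_closure_eq_empty)
  then obtain p where "p \<in> U" "p \<in> ball q e" "R < dist x p" by (auto simp: not_le)
  then show thesis by (rule that)
qed

text \<open>The segment itself is the crosscut and lies in \<open>ball x r\<close>. Points of
  \<open>U\<close> near \<open>c m\<close> and \<open>c 0\<close> can be chosen beyond
  \<open>R\<close>, where \<open>conn\<close> joins them off that disk.\<close>

lemma inner_crosscut_separates:
  fixes c :: "real \<Rightarrow> real^2"
  assumes jb: "jordan_boundary c U" and abm: "0 < a" "a < m" "m < b" "b < 1"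
    and far: "R < dist x (c 0)" "R < dist x (c m)" and seg: "closed_segment (c a) (c b) \<subseteq> ball x r"
    and inner: "open_segment (c a) (c b) \<subseteq> U"
    and conn: "\<And>p q. \<lbrakk>p \<in> U - ball x R; q \<in> U - ball x R\<rbrakk> \<Longrightarrow> connected_component (U - ball x r) p q"
  shows False
proof -
  have c: "simple_path c" and fr: "frontier U = path_image c"
    using jb by (auto simp: jordan_boundary_def)
  have cab: "c a \<noteq> c b" using simple_path_eqD[OF c, of a b] abm by auto
  obtain e where e: "e > 0" "\<And>p q. \<lbrakk>p \<in> ball (c m) e; q \<in> ball (c 0) e\<rbrakk>
      \<Longrightarrow> \<not> connected_component (U - path_image (linepath (c a) (c b))) p q"
    by (rule crosscut_separates[OF jb abm, of "linepath (c a) (c b)"])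
      (use cab inner in \<open>auto simp: closed_segment_eq_open\<close>)
  have "c m \<in> frontier U" "c 0 \<in> frontier U" using fr abm by (auto simp: path_image_def)
  then obtain p q where p: "p \<in> U" "p \<in> ball (c m) e" "R < dist x p"
    and q: "q \<in> U" "q \<in> ball (c 0) e" "R < dist x q"
    using frontier_approach e(1) far by metis
  have "connected_component (U - ball x r) p q" using p q by (intro conn) auto
  then have "connected_component (U - path_image (linepath (c a) (c b))) p q"
    using seg by (elim connected_component_of_subset) auto
  then show False using e(2) p q by blast
qed

text \<open>A crosscut \<open>g\<close> inside \<open>ball x R\<close> is built between accessible
  boundary points near \<open>c a\<close> and \<open>c b\<close>. Far points \<open>p\<close> and
  \<open>q\<close> are joined outside the disk, hence off \<open>S\<close>, and inside
  \<open>U\<close>, hence off \<open>T\<close>; Janiszewski's theorem then joins them in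
  \<open>U\<close> off \<open>g\<close>.\<close>

lemma outer_crosscut_separates:
  fixes c :: "real \<Rightarrow> real^2"
  assumes jb: "jordan_boundary c U" and abm: "0 < a" "a < m" "m < b" "b < 1"
    and far: "R < dist x (c 0)" "R < dist x (c m)" and seg: "closed_segment (c a) (c b) \<subseteq> ball x r"
    and rR: "r \<le> R"
    and outer: "closed_segment (c a) (c b) \<inter> U = {}"
    and conn: "\<And>p q. \<lbrakk>p \<in> ball x r \<inter> U; q \<in> ball x r \<inter> U\<rbrakk> \<Longrightarrow> path_component (ball x R \<inter> U) p q"
  shows False
proof -
  have c: "simple_path c" and fr: "frontier U = path_image c" and U: "open U" "connected U" "bounded U"
    using jb by (auto simp: jordan_boundary_def)
  have cont: "continuous_on {0..1} c"
    using c simple_path_imp_path path_def by blast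
  have dj: "U \<inter> path_image c = {}" using jordan_boundary_disjoint[OF jb] .
  have rR': "ball x r \<subseteq> ball x R" using rR by auto
  \<comment> \<open>The new parameters remain in \<open>(0, m)\<close> and \<open>(m, 1)\<close>, so
    they still separate \<open>c 0\<close> from \<open>c m\<close> on the boundary.\<close>
  obtain a' h where a': "0 < a'" "a' < m" "c ` closed_segment a a' \<subseteq> ball x r"
    and h: "path h" "pathstart h \<in> U" "pathfinish h = c a'" "path_image h \<subseteq> ball x r" "path_image h \<subseteq> U \<union> {c a'}"
    by (rule accessible_near[OF jb, of 0 a m "ball x r"]) (use abm seg in auto)
  obtain b' k where b': "m < b'" "b' < 1" "c ` closed_segment b b' \<subseteq> ball x r"
    and k: "path k" "pathstart k \<in> U" "pathfinish k = c b'" "path_image k \<subseteq> ball x r" "path_image k \<subseteq> U \<union> {c b'}"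
    by (rule accessible_near[OF jb, of m b 1 "ball x r"]) (use abm seg in auto)
  have "pathstart h \<in> ball x r \<inter> U" "pathstart k \<in> ball x r \<inter> U"
    using h k pathstart_in_path_image by blast+
  then have "path_component (ball x R \<inter> U) (pathstart h) (pathstart k)" by (rule conn)
  then obtain j where j: "path j" "path_image j \<subseteq> ball x R \<inter> U"
    "pathstart j = pathstart h" "pathfinish j = pathstart k"
    unfolding path_component_def by blast
  define w where "w = reversepath h +++ j +++ k"
  have w: "path w" "pathstart w = c a'" "pathfinish w = c b'"
    using h k j by (simp_all add: w_def)
  have "path_image w = path_image h \<union> path_image j \<union> path_image k"
    using h k j by (simp add: w_def path_image_join Un_assoc)
  then have wim: "path_image w \<subseteq> ball x R" "path_image w \<subseteq> U \<union> {c a', c b'}"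
    using h(4,5) k(4,5) j(2) rR' by auto
  have "c a' \<noteq> c b'" using simple_path_eqD[OF c, of a' b'] a' b' by auto
  \<comment> \<open>The concatenation \<open>w\<close> may cross itself, while a crosscut has to be
    an arc.\<close>
  then obtain g where g: "arc g" "path_image g \<subseteq> path_image w" "pathstart g = c a'" "pathfinish g = c b'"
    using path_contains_arc[OF w] by blast
  obtain e where e: "e > 0" "\<And>p q. \<lbrakk>p \<in> ball (c m) e; q \<in> ball (c 0) e\<rbrakk>
      \<Longrightarrow> \<not> connected_component (U - path_image g) p q"
    by (rule crosscut_separates[OF jb a'(1,2) b'(1,2) g(1,3,4)]) (use g(2) wim in blast)+
  have "c m \<in> frontier U" "c 0 \<in> frontier U" using fr abm by (auto simp: path_image_def)
  then obtain p q where p: "p \<in> U" "p \<in> ball (c m) e" "R < dist x p"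
    and q: "q \<in> U" "q \<in> ball (c 0) e" "R < dist x q"
    using frontier_approach e(1) far by metis
  define A B L where "A = c ` closed_segment a a'" and "B = c ` closed_segment b b'"
    and "L = closed_segment (c a) (c b)"
  have sub: "closed_segment a a' \<subseteq> {0..1}" "closed_segment b b' \<subseteq> {0..1}"
    using abm a' b' by (auto simp: closed_segment_eq_real_ivl)
  have AB: "compact A" "compact B" "connected A" "connected B" "A \<subseteq> path_image c" "B \<subseteq> path_image c"
    using sub unfolding A_def B_def path_image_def
    by (auto intro!: compact_continuous_image connected_continuous_image continuous_on_subset[OF cont])
  have ends: "c a \<in> A" "c a' \<in> A" "c b \<in> B" "c b' \<in> B" "c a \<in> L" "c b \<in> L"
    unfolding A_def B_def L_def by auto
  \<comment> \<open>\<open>A\<close> and \<open>B\<close> are the boundary arcs from the ends of \<open>L\<close> to the ends of the crosscut; adding them to \<open>S\<close>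
    makes \<open>S \<inter> T = A \<union> B \<union> L\<close> connected.\<close>
  define S T where "S = path_image g \<union> (A \<union> B \<union> L)" and "T = path_image c \<union> L"
  have "connected_component (- (S \<union> T)) p q"
  proof (rule Janiszewski_plane)
    show "compact S" unfolding S_def L_def using g(1) AB by (auto intro!: compact_Un compact_arc_image)
    show "closed T" unfolding T_def L_def using c by (auto intro: closed_simple_path_image)
    have "path_image g \<subseteq> U \<union> {c a', c b'}" using g(2) wim by blast
    then have "S \<inter> T = (A \<union> L) \<union> B"
      unfolding S_def T_def using AB(5,6) ends dj outer[folded L_def] by blast
    moreover have "connected (A \<union> L)"
      using AB(3) ends by (intro connected_Un) (auto simp: L_def)
    then have "connected (A \<union> L \<union> B)" using AB(4) ends by (intro connected_Un[of "A \<union> L" B]) auto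
    ultimately show "connected (S \<inter> T)" by simp
    have "S \<subseteq> ball x R"
      unfolding S_def A_def B_def L_def using g(2) wim(1) a'(3) b'(3) seg rR' by blast
    moreover have "connected (- ball x R)"
      by (rule connected_complement_bounded_convex) auto
    moreover have "p \<in> - ball x R" "q \<in> - ball x R" using p q by auto
    ultimately show "connected_component (- S) p q"
      unfolding connected_component_def by blast
    have "U \<subseteq> - T" unfolding T_def L_def using dj outer by blast
    then show "connected_component (- T) p q"
      using U(2) p q unfolding connected_component_def by blast
  qed
  then obtain X where X: "connected X" "X \<subseteq> - (S \<union> T)" "p \<in> X" "q \<in> X"
    unfolding connected_component_def by blast
  have "X \<inter> frontier U = {}" using X(2) fr unfolding T_def by blast
  then have "X \<subseteq> U" using connected_Int_frontier[of X U] X p by blast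
  then have "connected_component (U - path_image g) p q"
    using X unfolding connected_component_def S_def by blast
  then show False using e(2) p q by blast
qed

text \<open>Once the open segment misses the boundary, connectedness puts it either inside
  \<open>U\<close>, against \<open>conn2\<close>, or outside, against \<open>conn1\<close>.\<close>

lemma boundary_quadruple_near_disk:
  fixes c :: "real \<Rightarrow> real^2"
  assumes jb: "jordan_boundary c U" and abm: "0 < a" "a < m" "m < b" "b < 1"
    and far: "R < dist x (c 0)" "R < dist x (c m)" and seg: "closed_segment (c a) (c b) \<subseteq> ball x r"
    and rR: "r \<le> R"
    and conn1: "\<And>p q. \<lbrakk>p \<in> ball x r \<inter> U; q \<in> ball x r \<inter> U\<rbrakk> \<Longrightarrow> path_component (ball x R \<inter> U) p q"
    and conn2: "\<And>p q. \<lbrakk>p \<in> U - ball x R; q \<in> U - ball x R\<rbrakk> \<Longrightarrow> connected_component (U - ball x r) p q"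
  shows False
proof -
  have c: "simple_path c" "pathfinish c = pathstart c" and fr: "frontier U = path_image c"
    using jb by (auto simp: jordan_boundary_def)
  have "c 0 \<notin> ball x r" "c m \<notin> ball x r" using far rR by auto
  then have "c 0 \<notin> closed_segment (c a) (c b)" "c m \<notin> closed_segment (c a) (c b)"
    using seg by blast+
  then obtain a' b' where ab': "0 < a'" "a' < m" "m < b'" "b' < 1"
    and sub: "closed_segment (c a') (c b') \<subseteq> closed_segment (c a) (c b)"
    and op: "open_segment (c a') (c b') \<inter> path_image c = {}"
    by (rule boundary_subsegment[OF c abm])
  have seg': "closed_segment (c a') (c b') \<subseteq> ball x r" using sub seg by blast
  show False
  proof (cases "open_segment (c a') (c b') \<subseteq> U")
    case True
    show ?thesis
      by (rule inner_crosscut_separates[OF jb ab' far seg' True conn2])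
  next
    case False
    have "open_segment (c a') (c b') \<inter> U = {}"
      using connected_Int_frontier[OF convex_connected[OF convex_open_segment], of "c a'" "c b'" U] op fr False
      by blast
    moreover have "c a' \<notin> U" "c b' \<notin> U"
      using jordan_boundary_disjoint[OF jb] ab' by (auto simp: path_image_def)
    ultimately have "closed_segment (c a') (c b') \<inter> U = {}"
      by (auto simp: closed_segment_eq_open)
    then show ?thesis
      by (rule outer_crosscut_separates[OF jb ab' far seg' rR _ conn1])
  qed
qed

section \<open>Far points on both boundary arcs\<close>

lemma loop_parameters:
  assumes "simple_path c" "pathfinish c = pathstart c"
    and "P1 \<in> path_image c - {c 0}" "P2 \<in> path_image c - {c 0}" "P1 \<noteq> P2"
  obtains a b where "0 < a" "a < b" "b < 1" "{c a, c b} = {P1, P2}"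
proof -
  have c01: "c 0 = c 1" using assms by (simp add: pathstart_def pathfinish_def)
  have par: "\<exists>s. 0 < s \<and> s < 1 \<and> c s = P" if P: "P \<in> path_image c - {c 0}" for P
  proof -
    obtain s where s: "s \<in> {0..1}" "c s = P" using P by (auto simp: path_image_def)
    then have "s \<noteq> 0" "s \<noteq> 1" using P c01 by auto
    then show ?thesis using s by (intro exI[of _ s]) auto
  qed
  obtain s t where st: "0 < s" "s < 1" "c s = P1" "0 < t" "t < 1" "c t = P2"
    using par assms by metis
  have "s \<noteq> t" using st assms(5) by auto
  then show thesis
    using st by (cases "s < t") (auto intro: that[of s t] that[of t s])
qed

lemma diameter_subset_cball:
  fixes S :: "'a::real_normed_vector set"
  assumes "S \<subseteq> cball x R" "0 \<le> R"
  shows "diameter S \<le> 2 * R"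
proof (rule diameter_le)
  fix y z assume "y \<in> S" "z \<in> S"
  then have "dist x y \<le> R" "dist x z \<le> R" using assms by auto
  then show "norm (y - z) \<le> 2 * R" using dist_triangle3[of y z x] by (simp add: dist_norm)
qed (use assms in simp)

text \<open>An arc of diameter above \<open>2 * R\<close> leaves \<open>cball x R\<close>, so both
  arcs contain far points. With the base point moved to the far point of one arc, the other arc is
  the image of the open parameter interval between the given points and contains
  \<open>c m\<close>.\<close>

lemma far_boundary_quadruple:
  assumes jd: "jordan_domain \<Omega>" and P: "P1 \<in> frontier \<Omega>" "P2 \<in> frontier \<Omega>" "P1 \<noteq> P2"
    and R: "0 \<le> R" "dist x P1 \<le> R" "dist x P2 \<le> R"
    and big: "2 * R < Min (diameter ` components (frontier \<Omega> - {P1, P2}))"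
  obtains c a m b where "jordan_boundary c \<Omega>" "0 < a" "a < m" "m < b" "b < 1"
    "{c a, c b} = {P1, P2}" "R < dist x (c 0)" "R < dist x (c m)"
proof -
  \<comment> \<open>A first parametrization needs a base point other than \<open>P1\<close> and
    \<open>P2\<close>; it exists because a connected boundary with two points is infinite.\<close>
  obtain Q where Q: "Q \<in> frontier \<Omega>" "Q \<noteq> P1" "Q \<noteq> P2"
  proof -
    obtain c where c: "jordan_boundary c \<Omega>" "c 0 = P1"
      using jordan_domain_boundary[OF jd P(1)] .
    then have "connected (frontier \<Omega>)"
      by (simp add: jordan_boundary_def connected_simple_path_image)
    then have "infinite (frontier \<Omega>)" using P connected_finite_iff_sing by force
    then have "infinite (frontier \<Omega> - {P1, P2})" by simp
    then show thesis using that by (metis DiffE ex_in_conv finite.emptyI insertCI)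
  qed
  have comps: "\<exists>a b. 0 < a \<and> a < b \<and> b < 1 \<and> {c a, c b} = {P1, P2} \<and>
      components (frontier \<Omega> - {P1, P2}) = {c ` {a<..<b}, c ` ({0..<a} \<union> {b<..1})}"
    if jb: "jordan_boundary c \<Omega>" "c 0 \<noteq> P1" "c 0 \<noteq> P2" for c
  proof -
    have c: "simple_path c" "pathfinish c = pathstart c" and fr: "frontier \<Omega> = path_image c"
      using jb by (auto simp: jordan_boundary_def)
    obtain a b where ab: "0 < a" "a < b" "b < 1" "{c a, c b} = {P1, P2}"
      by (rule loop_parameters[OF c, of P1 P2]) (use P fr jb in auto)
    then show ?thesis using components_loop_minus_two_points[OF c ab(1-3)] fr by auto
  qed
  obtain c where c: "jordan_boundary c \<Omega>" "c 0 = Q"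
    using jordan_domain_boundary[OF jd Q(1)] .
  obtain a b where ab: "0 < a" "a < b" "b < 1"
    "components (frontier \<Omega> - {P1, P2}) = {c ` {a<..<b}, c ` ({0..<a} \<union> {b<..1})}"
    using comps[OF c(1)] c(2) Q by auto
  define A B where "A = c ` {a<..<b}" and "B = c ` ({0..<a} \<union> {b<..1})"
  have AB: "components (frontier \<Omega> - {P1, P2}) = {A, B}" using ab by (simp add: A_def B_def)
  have "simple_path c" using c by (simp add: jordan_boundary_def)
  have disj: "A \<inter> B = {}"
  proof (rule equals0I)
    fix z assume "z \<in> A \<inter> B"
    then obtain s t where "s \<in> {a<..<b}" "t \<in> {0..<a} \<union> {b<..1}" "c s = c t"
      unfolding A_def B_def by blast
    then show False using simple_path_eqD[OF \<open>simple_path c\<close>, of t s] ab by auto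
  qed
  have "2 * R < diameter A" "2 * R < diameter B" using big AB by simp_all
  then have "\<not> A \<subseteq> cball x R" "\<not> B \<subseteq> cball x R"
    using diameter_subset_cball R(1) by (metis not_less)+
  then obtain Q1 Q2 where Q12: "Q1 \<in> A" "R < dist x Q1" "Q2 \<in> B" "R < dist x Q2"
    by (auto simp: subset_iff not_le)
  have "B \<subseteq> frontier \<Omega>" using AB in_components_subset by blast
  then have "Q2 \<in> frontier \<Omega>" using Q12 by blast
  then obtain e where e: "jordan_boundary e \<Omega>" "e 0 = Q2"
    using jordan_domain_boundary[OF jd] by blast
  have "Q2 \<noteq> P1" "Q2 \<noteq> P2" using Q12(4) R by auto
  then obtain u v where uv: "0 < u" "u < v" "v < 1" "{e u, e v} = {P1, P2}"
    "components (frontier \<Omega> - {P1, P2}) = {e ` {u<..<v}, e ` ({0..<u} \<union> {v<..1})}"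
    using comps[OF e(1)] e(2) by auto
  \<comment> \<open>\<open>Q2\<close> is on the arc through the new base point, so \<open>A\<close>,
    which is disjoint from \<open>B\<close>, must be the other one.\<close>
  have "Q2 \<in> e ` ({0..<u} \<union> {v<..1})" using uv(1) e(2) by auto
  then have "A \<noteq> e ` ({0..<u} \<union> {v<..1})" using disj Q12(3) by (metis disjoint_iff)
  moreover have "A \<in> {e ` {u<..<v}, e ` ({0..<u} \<union> {v<..1})}"
    unfolding uv(5)[symmetric] AB by simp
  ultimately have "A = e ` {u<..<v}" by simp
  then obtain m where "u < m" "m < v" "e m = Q1" using Q12 by auto
  then show thesis using that[OF e(1) uv(1), of m v] uv Q12 e(2) by auto
qed

lemma locally_connected_imp_three_point:
  assumes jd: "jordan_domain \<Omega>" and \<psi>: "control_function \<psi>" and C: "C \<ge> 1"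
    and lc: "psi_inv_locally_connected (\<lambda>t. \<psi> (C * t)) \<Omega>"
  shows "three_point_property \<psi> \<Omega>"
proof -
  obtain K where K: "K \<ge> 1" "\<And>s. 0 \<le> s \<Longrightarrow> 2 * \<psi> s \<le> \<psi> (K * s)"
    by (rule control_function_doubling[OF \<psi>]) blast
  have "1 * 1 \<le> K * (2 * C)" using K C by (intro mult_mono) auto
  then have C1: "K * (2 * C) \<ge> 1" by simp
  have "Min (diameter ` components (frontier \<Omega> - {P1, P2})) \<le> \<psi> (K * (2 * C) * dist P1 P2)"
    if P: "P1 \<in> frontier \<Omega>" "P2 \<in> frontier \<Omega>" "P1 \<noteq> P2" for P1 P2
  proof (rule ccontr)
    \<comment> \<open>The factor 2 places the whole segment in the open disk of radius
      \<open>r\<close> about \<open>P1\<close>. Condition (i) leads from \<open>r\<close> to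
      \<open>R\<close> and (ii) from \<open>R\<close> back to \<open>r\<close>; the constant
      \<open>K * (2 * C)\<close> makes the denied bound at least \<open>2 * R\<close>.\<close>
    define d r R where "d = dist P1 P2" and "r = 2 * d" and "R = \<psi> (C * r)"
    assume "\<not> Min (diameter ` components (frontier \<Omega> - {P1, P2})) \<le> \<psi> (K * (2 * C) * dist P1 P2)"
    moreover have "d > 0" "r > 0" using P(3) by (simp_all add: d_def r_def)
    moreover have "2 * R \<le> \<psi> (K * (2 * C) * d)"
      using K(2)[of "C * r"] C \<open>r > 0\<close> by (simp add: R_def r_def mult_ac)
    ultimately have big: "2 * R < Min (diameter ` components (frontier \<Omega> - {P1, P2}))"
      by (simp add: d_def)
    have "1 * r \<le> C * r" using C \<open>r > 0\<close> by (intro mult_right_mono) auto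
    also have "\<dots> \<le> R" unfolding R_def using C \<open>r > 0\<close> by (intro control_function_ge[OF \<psi>]) auto
    finally have rR: "r \<le> R" by simp
    have inv: "psi_inv (\<lambda>t. \<psi> (C * t)) R = r"
      unfolding R_def using \<open>r > 0\<close> by (intro psi_inv_rescaled[OF \<psi> C]) simp
    have "d \<le> R" using rR \<open>d > 0\<close> unfolding r_def by linarith
    then have R0: "R > 0" "0 \<le> R" "dist P1 P1 \<le> R" "dist P1 P2 \<le> R"
      using \<open>d > 0\<close> by (simp_all flip: d_def)
    obtain c a m b where c: "jordan_boundary c \<Omega>" "0 < a" "a < m" "m < b" "b < 1"
      "{c a, c b} = {P1, P2}" "R < dist P1 (c 0)" "R < dist P1 (c m)"
      using far_boundary_quadruple[OF jd P R0(2-4) big] .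
    have "closed_segment (c a) (c b) = closed_segment P1 P2"
      using c(6) by (auto simp: doubleton_eq_iff closed_segment_commute)
    moreover have "closed_segment P1 P2 \<subseteq> ball P1 r"
      using \<open>d > 0\<close> by (intro closed_segment_subset) (auto simp: r_def d_def)
    ultimately have seg: "closed_segment (c a) (c b) \<subseteq> ball P1 r" by (rule ord_eq_le_trans)
    show False
    proof (rule boundary_quadruple_near_disk[OF c(1-5,7,8) seg rR])
      fix p q assume pq: "p \<in> ball P1 r \<inter> \<Omega>" "q \<in> ball P1 r \<inter> \<Omega>"
      \<comment> \<open>Local connectivity speaks of distinct points, so \<open>p = q\<close> is
        treated separately.\<close>
      show "path_component (ball P1 R \<inter> \<Omega>) p q"
      proof (cases "p = q")
        case True
        have "p \<in> ball P1 R \<inter> \<Omega>" using pq(1) rR by auto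
        then show ?thesis using True path_component_refl by blast
      next
        case False
        then have "joined_by_arc_in (ball P1 R \<inter> \<Omega>) p q"
          using lc pq \<open>r > 0\<close> unfolding psi_inv_locally_connected_def R_def by blast
        then show ?thesis
          unfolding joined_by_arc_in_def path_component_def by (blast intro: arc_imp_path)
      qed
    next
      fix p q assume pq: "p \<in> \<Omega> - ball P1 R" "q \<in> \<Omega> - ball P1 R"
      show "connected_component (\<Omega> - ball P1 r) p q"
      proof (cases "p = q")
        case True
        have "p \<in> \<Omega> - ball P1 r" using pq(1) rR by auto
        then show ?thesis using True by simp
      next
        case False
        then have "joined_by_arc_in (\<Omega> - ball P1 (psi_inv (\<lambda>t. \<psi> (C * t)) R)) p q"
          using lc pq R0(1) unfolding psi_inv_locally_connected_def by blast
        then show ?thesis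
          unfolding joined_by_arc_in_def inv
          by (metis connected_arc_image connected_component_def pathfinish_in_path_image pathstart_in_path_image)
      qed
    qed
  qed
  then show ?thesis using C1 unfolding three_point_property_def by blast
qed

theorem lemma3p1:
  fixes \<Omega> :: "(real^2) set" and \<psi> :: "real \<Rightarrow> real"
  assumes "jordan_domain \<Omega>" and "control_function \<psi>"
  shows "three_point_property \<psi> \<Omega> \<longleftrightarrow>
    (\<exists>C\<ge>1. psi_inv_locally_connected (\<lambda>t. \<psi> (C * t)) \<Omega>)"
  using three_point_imp_locally_connected[OF assms] locally_connected_imp_three_point[OF assms]
  by blast

end
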